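(* (1) For every lattice polytope $P$ of dimension $2$ which is Ehrhart positive, the Ehrhart polynomial $E_{2P}(n)$ of the dilation $2P$ is magic positive. (2) For every integer $d\ge 3$ and every positive integer $k$, there exists a lattice polytope $P$ of dimension $d$ which is Ehrhart positive and such that the Ehrhart polynomial $E_{kP}(n)$ of the dilation $kP$ is not magic positive.
   Context: A lattice polytope is the convex hull of finitely many points of $\mathbb{Z}^N\subset\mathbb{R}^N$. For a lattice polytope $P$, its Ehrhart polynomial $E_P(n)$ is the polynomial of degree $\dim P$ with $E_P(n)=|nP\cap\mathbb{Z}^N|$ for all integers $n>0$; for a positive integer $k$, $E_{kP}(n)=E_P(kn)$. The polytope $P$ is called Ehrhart positive if all coefficients of $E_P(n)$ (in degrees $0,\dots,\dim P$) are positive. A real polynomial $g(n)$ of degree $d$ is called magic positive if, in its unique expansion $g(n)=\sum_{i=0}^d a_i\,n^i(n+1)^{d-i}$, all coefficients satisfy $a_i\ge 0$. *)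

theory Defs
  imports
    "HOL-Analysis.Analysis"
    "HOL-Analysis.Finite_Function_Topology"
    "HOL-Computational_Algebra.Polynomial"
begin

text \<open>
  The number \<open>N\<close> of coordinates is bound inside the formulas below, so \<open>\<real>\<^sup>N\<close> is
  not a type here. A point of \<open>\<real>\<^sup>N\<close> is a finitely supported function
  \<open>nat \<Rightarrow>\<^sub>0 real\<close> that vanishes outside \<open>{..<N}\<close>; these functions form a real
  vector space in the library, so that \<open>convex hull\<close>, \<open>affine hull\<close> and \<open>dim\<close> apply.
\<close>

definition int_lattice :: "nat \<Rightarrow> (nat \<Rightarrow>\<^sub>0 real) set" where
  "int_lattice N =
     {x. Poly_Mapping.keys x \<subseteq> {..<N} \<and> (\<forall>i. Poly_Mapping.lookup x i \<in> \<int>)}"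

definition lattice_polytope :: "nat \<Rightarrow> (nat \<Rightarrow>\<^sub>0 real) set \<Rightarrow> bool" where
  "lattice_polytope N P \<longleftrightarrow>
     (\<exists>S. finite S \<and> S \<subseteq> int_lattice N \<and> P = convex hull S)"

text \<open>
  The library's \<open>aff_dim\<close> requires a Euclidean space, so the dimension of the affine
  hull is taken as the linear dimension of its direction space. The empty set gets
  dimension \<open>0\<close> (not \<open>-1\<close>).
\<close>

definition affine_dimension :: "'a::real_vector set \<Rightarrow> nat" where
  "affine_dimension P = dim {x - y |x y. x \<in> affine hull P \<and> y \<in> affine hull P}"

definition dilate :: "nat \<Rightarrow> 'a::real_vector set \<Rightarrow> 'a set" where
  "dilate k P = (\<lambda>x. real k *\<^sub>R x) ` P"

text \<open>
  Two polynomials agreeing at all positive integers are equal, so there is at most one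
  such \<open>p\<close>; for a nonempty lattice polytope in \<open>\<real>\<^sup>N\<close> it exists by Ehrhart's theorem.
\<close>

definition ehrhart_poly :: "nat \<Rightarrow> (nat \<Rightarrow>\<^sub>0 real) set \<Rightarrow> real poly" where
  "ehrhart_poly N P =
     (THE p. degree p = affine_dimension P \<and>
        (\<forall>n::nat. n > 0 \<longrightarrow> poly p (real n) = real (card (dilate n P \<inter> int_lattice N))))"

definition ehrhart_positive :: "nat \<Rightarrow> (nat \<Rightarrow>\<^sub>0 real) set \<Rightarrow> bool" where
  "ehrhart_positive N P \<longleftrightarrow> (\<forall>i \<le> affine_dimension P. coeff (ehrhart_poly N P) i > 0)"

text \<open>
  The polynomials \<open>n\<^sup>i (n + 1)\<^sup>d\<^sup>-\<^sup>i\<close> for \<open>i \<le> d\<close> are a basis of the polynomials of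
  degree at most \<open>d\<close>, so the coefficients \<open>a i\<close> with \<open>i \<le> d\<close> are determined by \<open>g\<close>.
\<close>

definition magic_positive :: "real poly \<Rightarrow> bool" where
  "magic_positive g \<longleftrightarrow>
     (\<exists>a::nat \<Rightarrow> real. (\<forall>i \<le> degree g. a i \<ge> 0) \<and>
        g = (\<Sum>i \<le> degree g. smult (a i) ([:0, 1:] ^ i * [:1, 1:] ^ (degree g - i))))"

end

theory Submission
  imports Defs
begin

text \<open>
  Part 1. In lattice coordinates of its plane, a polygon is glued from lattice triangles along
  chords, and a lattice triangle is half of a parallelogram. Hence \<open>E(n) = A n\<^sup>2 + b n + 1\<close> with
  \<open>0 \<le> E(-1) = A - b + 1\<close> at most the number of interior lattice points. The vertices are at least
  three points of \<open>P\<close> outside the interior, so \<open>2 b = E(1) - E(-1) \<ge> 3\<close>. The coefficients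
  \<open>1\<close>, \<open>2 b - 2\<close> and \<open>4 A - 2 b + 1 = 4 E(-1) + 2 b - 3\<close> of \<open>E(2 n)\<close> are therefore nonnegative.

  Part 2. Let \<open>P\<close> be the convex hull of the unit vectors of \<open>\<real>\<^sup>d\<close> and of \<open>(-m, \<dots>, -m)\<close>. Its Ehrhart
  polynomial is \<open>C(n + d, d) + m (C(n + d, d + 1) - C(n, d + 1))\<close> (the \<open>h\<^sup>*\<close>-vector is
  \<open>(1, m, \<dots>, m)\<close>). The factor of \<open>m\<close> has the parity of \<open>d\<close> and nonnegative coefficients, so with \<open>E(n) = \<Sum>\<^sub>j e\<^sub>j n\<^sup>j\<close>, in
  \<open>a\<^bsub>d - 1\<^esub> = \<Sum>\<^sub>j (-1)\<^bsup>d - 1 - j\<^esup> (d - j) k\<^sup>j e\<^sub>j\<close> all its contributions are \<open>\<le> 0\<close>; that of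
  \<open>j = d - 2 \<ge> 1\<close> is negative. So \<open>a\<^bsub>d - 1\<^esub> < 0\<close> once \<open>m\<close> is large.
\<close>

subsection \<open>Ehrhart polynomials\<close>

text \<open>\<open>ehrhart_poly\<close> is a definite description, so each use of it calls for an
  explicit polynomial that has the right degree and the right values; both halves therefore rest on
  exact counts. Part 1: a linear chart of the plane of the polygon need not turn the integer points
  of that plane into the integer points of \<open>real \<times> real\<close>. Areas, edge lengths
  and counts are therefore measured relative to an arbitrary discrete subgroup. Why the factor 2:
  \<open>A n^2 + b n + 1 = (n + 1)^2 + (b - 2) n (n + 1) + (A - b + 1) n^2\<close>, so only
  \<open>b < 2\<close> is harmful, as for a triangle with exactly three boundary points, where
  \<open>b = 3/2\<close>; doubling turns \<open>b\<close> into \<open>2 b \<ge> 3\<close>. Part 2: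
  the last vertex lies in direction \<open>-(1, ..., 1)\<close>, so every integer point with a
  negative coordinate is a translate along \<open>(1, ..., 1)\<close> of a nonnegative point with a
  zero coordinate. The number of admissible translates is proportional to \<open>m\<close>, which
  makes the count affine in \<open>m\<close>. The constant term of the factor of \<open>m\<close>
  vanishes, so its coefficient of degree \<open>d - 2\<close> is of use only from
  \<open>d = 3\<close> on.\<close>

lemma lookup_scaleR_real [simp]:
  "Poly_Mapping.lookup (r *\<^sub>R x) i = r * Poly_Mapping.lookup x i"
  for x :: "'a \<Rightarrow>\<^sub>0 real"
proof -
  have "finite {i. r * Poly_Mapping.lookup x i \<noteq> 0}"
    by (rule finite_subset [OF _ finite_lookup [of x]]) auto
  then show ?thesis
    by (simp add: scaleR_poly_mapping_def)
qed

lemma lookup_sum_real [simp]: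
  "Poly_Mapping.lookup (\<Sum>a\<in>A. f a) i = (\<Sum>a\<in>A. Poly_Mapping.lookup (f a) i)"
  for f :: "'b \<Rightarrow> 'a \<Rightarrow>\<^sub>0 real"
  by (rule lookup_sum)

lemma real_poly_eqI_positive_nats:
  fixes p q :: "real poly"
  assumes "\<And>n::nat. n > 0 \<Longrightarrow> poly p (real n) = poly q (real n)"
  shows "p = q"
proof (rule ccontr)
  assume "p \<noteq> q"
  then have "finite {x. poly (p - q) x = 0}"
    by (intro poly_roots_finite) auto
  moreover have "real ` {0<..} \<subseteq> {x. poly (p - q) x = 0}"
    using assms by auto
  ultimately have "finite (real ` {0<..})"
    by (rule rev_finite_subset)
  then have "finite {0::nat<..}"
    by (rule finite_imageD) (simp add: inj_on_def)
  then show False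
    by (simp add: infinite_Ioi)
qed

text \<open>Uniqueness comes from agreement at infinitely many points, so exhibiting one polynomial
  settles the definite description.\<close>

lemma ehrhart_poly_eqI:
  assumes "degree p = affine_dimension P"
    and "\<And>n::nat. n > 0 \<Longrightarrow> poly p (real n) = real (card (dilate n P \<inter> int_lattice N))"
  shows "ehrhart_poly N P = p"
  unfolding ehrhart_poly_def
  by (rule the_equality) (use assms in \<open>auto intro: real_poly_eqI_positive_nats\<close>)

text \<open>The differences of points of \<open>a + W\<close> form \<open>W\<close> itself. Allowing
  any \<open>S\<close> with the same affine hull lets a finite vertex set stand in for the
  polytope.\<close>

lemma affine_dimension_eq_dim:
  fixes P S :: "'a::real_vector set"
  assumes "a \<in> S" and hull: "affine hull P = affine hull S"
  shows "affine_dimension P = dim ((\<lambda>x. x - a) ` S)"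
proof -
  define W where "W = span ((\<lambda>x. x - a) ` S)"
  have *: "affine hull S = (\<lambda>x. a + x) ` W"
  proof -
    have eq: "(\<lambda>x. x - a) ` S = insert 0 {x - a | x. x \<in> S - {a}}"
      using \<open>a \<in> S\<close> by auto
    show ?thesis
      unfolding W_def eq span_insert_0 affine_hull_span [OF \<open>a \<in> S\<close>] by auto
  qed
  have "{x - y |x y. x \<in> affine hull P \<and> y \<in> affine hull P} = {x - y |x y. x \<in> W \<and> y \<in> W}"
  proof (intro equalityI subsetI)
    fix z assume "z \<in> {x - y |x y. x \<in> affine hull P \<and> y \<in> affine hull P}"
    then obtain v w where "z = (a + v) - (a + w)" "v \<in> W" "w \<in> W"
      unfolding hull * by blast
    then show "z \<in> {x - y |x y. x \<in> W \<and> y \<in> W}"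
      by auto
  next
    fix z assume "z \<in> {x - y |x y. x \<in> W \<and> y \<in> W}"
    then obtain v w where "z = (a + v) - (a + w)" "v \<in> W" "w \<in> W"
      by auto
    then show "z \<in> {x - y |x y. x \<in> affine hull P \<and> y \<in> affine hull P}"
      unfolding hull * by blast
  qed
  also have "\<dots> = W"
  proof
    show "{x - y |x y. x \<in> W \<and> y \<in> W} \<subseteq> W"
      by (auto simp: W_def intro: span_diff)
    show "W \<subseteq> {x - y |x y. x \<in> W \<and> y \<in> W}"
    proof
      fix x assume "x \<in> W"
      moreover have "0 \<in> W" by (simp add: W_def span_zero)
      ultimately show "x \<in> {x - y |x y. x \<in> W \<and> y \<in> W}"
        by (metis (mono_tags, lifting) diff_zero mem_Collect_eq)
    qed
  qed
  finally show ?thesis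
    by (simp add: affine_dimension_def W_def)
qed

lemma affine_dimension_dilate:
  assumes "k > 0"
  shows "affine_dimension (dilate k P) = affine_dimension P"
proof (cases "P = {}")
  case True
  then show ?thesis by (simp add: dilate_def)
next
  case False
  then obtain a where a: "a \<in> P" by blast
  have "(\<lambda>x. x - real k *\<^sub>R a) ` dilate k P = (\<lambda>x. real k *\<^sub>R x) ` ((\<lambda>x. x - a) ` P)"
    by (simp add: dilate_def image_image scaleR_diff_right)
  then have "span ((\<lambda>x. x - real k *\<^sub>R a) ` dilate k P) = span ((\<lambda>x. real k *\<^sub>R x) ` ((\<lambda>x. x - a) ` P))"
    by simp
  also have "\<dots> = span ((\<lambda>x. x - a) ` P)"
  proof (rule span_eq[THEN iffD2], intro conjI subsetI)
    fix x assume "x \<in> (\<lambda>x. real k *\<^sub>R x) ` ((\<lambda>x. x - a) ` P)"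
    then obtain z where "z \<in> (\<lambda>x. x - a) ` P" "x = real k *\<^sub>R z" by blast
    then show "x \<in> span ((\<lambda>x. x - a) ` P)"
      by (simp add: span_scale span_base)
  next
    fix x assume x: "x \<in> (\<lambda>x. x - a) ` P"
    have "x = (1 / real k) *\<^sub>R (real k *\<^sub>R x)"
      using assms by simp
    also have "\<dots> \<in> span ((\<lambda>x. real k *\<^sub>R x) ` ((\<lambda>x. x - a) ` P))"
      using x by (intro span_scale span_base) auto
    finally show "x \<in> span ((\<lambda>x. real k *\<^sub>R x) ` ((\<lambda>x. x - a) ` P))" .
  qed
  finally have sp: "span ((\<lambda>x. x - real k *\<^sub>R a) ` dilate k P) = span ((\<lambda>x. x - a) ` P)" .
  have "real k *\<^sub>R a \<in> dilate k P"
    using a by (auto simp: dilate_def)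
  then show ?thesis
    using affine_dimension_eq_dim [OF a refl] affine_dimension_eq_dim [OF _ refl] sp
    by (metis dim_span)
qed

lemma dilate_dilate: "dilate n (dilate k P) = dilate (n * k) P"
  by (simp add: dilate_def image_image)

text \<open>Dilating \<open>dilate k P\<close> by \<open>n\<close> is dilating \<open>P\<close> by
  \<open>n * k\<close>, so the variable is scaled by \<open>k\<close>; \<open>k > 0\<close>
  preserves both the degree and the dimension.\<close>

lemma ehrhart_poly_dilate:
  assumes "degree p = affine_dimension P" and "k > 0"
    and "\<And>n::nat. n > 0 \<Longrightarrow> poly p (real n) = real (card (dilate n P \<inter> int_lattice N))"
  shows "ehrhart_poly N (dilate k P) = p \<circ>\<^sub>p [:0, real k:]"
proof (rule ehrhart_poly_eqI)
  show "degree (p \<circ>\<^sub>p [:0, real k:]) = affine_dimension (dilate k P)"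
    using assms by (simp add: affine_dimension_dilate degree_pcompose)
  fix n :: nat assume "n > 0"
  then show "poly (p \<circ>\<^sub>p [:0, real k:]) (real n) = real (card (dilate n (dilate k P) \<inter> int_lattice N))"
    using assms(2) assms(3)[of "n * k"] by (simp add: poly_pcompose dilate_dilate)
qed

subsection \<open>Lattice points of the skew simplex\<close>

text \<open>The integer points of \<open>n\<close> times the standard simplex. The slack
  \<open>n - sum_list l\<close> will bound, up to the factor \<open>m\<close>, how far a point can
  be moved towards the apex.\<close>

definition bounded_lists :: "nat \<Rightarrow> nat \<Rightarrow> nat list set" where
  "bounded_lists d n = {l. length l = d \<and> sum_list l \<le> n}"

lemma finite_bounded_lists [simp]: "finite (bounded_lists d n)"
proof (rule finite_subset)
  show "bounded_lists d n \<subseteq> {l. set l \<subseteq> {..n} \<and> length l = d}"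
    using member_le_sum_list by (fastforce simp: bounded_lists_def)
qed (simp add: finite_lists_length_eq)

text \<open>Prepending the slack gives a composition of \<open>n\<close> into \<open>d + 1\<close>
  nonnegative parts.\<close>

lemma card_bounded_lists: "card (bounded_lists d n) = (n + d) choose d"
proof -
  have "bij_betw (\<lambda>l. (n - sum_list l) # l) (bounded_lists d n) {l. length l = Suc d \<and> sum_list l = n}"
  proof (rule bij_betw_byWitness [where f' = tl])
    show "(\<lambda>l. (n - sum_list l) # l) ` bounded_lists d n \<subseteq> {l. length l = Suc d \<and> sum_list l = n}"
      by (auto simp: bounded_lists_def)
    show "tl ` {l. length l = Suc d \<and> sum_list l = n} \<subseteq> bounded_lists d n"
      by (auto simp: bounded_lists_def length_Suc_conv)
  qed (auto simp: bounded_lists_def length_Suc_conv)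
  then have "card (bounded_lists d n) = card {l::nat list. length l = Suc d \<and> sum_list l = n}"
    by (rule bij_betw_same_card)
  also have "\<dots> = (n + d) choose n"
    using card_length_sum_list [of "Suc d" n] by simp
  also have "\<dots> = (n + d) choose d"
    by (metis add_diff_cancel_left' binomial_symmetric le_add1)
  finally show ?thesis .
qed

text \<open>Passing from \<open>n\<close> to \<open>n + 1\<close> raises every slack by one, and the
  new lists have slack 0; the recurrence is Pascal's rule.\<close>

lemma sum_slack_bounded_lists:
  "(\<Sum>l\<in>bounded_lists d n. n - sum_list l) = (n + d) choose (Suc d)"
proof (induction n)
  case 0
  show ?case by (simp add: bounded_lists_def)
next
  case (Suc n)
  have "(\<Sum>l\<in>bounded_lists d (Suc n). Suc n - sum_list l)
      = (\<Sum>l\<in>bounded_lists d n. Suc n - sum_list l)"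
    by (rule sum.mono_neutral_right [OF finite_bounded_lists]) (auto simp: bounded_lists_def)
  also have "\<dots> = (\<Sum>l\<in>bounded_lists d n. (n - sum_list l) + 1)"
    by (rule sum.cong) (auto simp: bounded_lists_def)
  also have "\<dots> = (Suc n + d) choose (Suc d)"
    unfolding sum.distrib Suc.IH by (simp add: card_bounded_lists)
  finally show ?case .
qed

text \<open>Lowering all \<open>d\<close> entries by one gives the lists bounded by
  \<open>n - d\<close>, with the same slack. For \<open>n < d\<close> there are no such lists and
  the binomial coefficient is 0.\<close>

lemma sum_slack_positive_lists:
  "(\<Sum>l\<in>{l \<in> bounded_lists d n. 0 \<notin> set l}. n - sum_list l) = n choose (Suc d)"
proof -
  have pos: "l = map Suc (map (\<lambda>x. x - 1) l)" if "0 \<notin> set l" for l :: "nat list"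
    using that by (induction l) auto
  have sum_Suc: "sum_list (map Suc l) = sum_list l + length l" for l
    by (induction l) auto
  show ?thesis
  proof (cases "d \<le> n")
    case True
    have "(\<Sum>l\<in>{l \<in> bounded_lists d n. 0 \<notin> set l}. n - sum_list l)
        = (\<Sum>l\<in>bounded_lists d (n - d). n - d - sum_list l)"
    proof (rule sum.reindex_bij_witness [where i = "map Suc" and j = "map (\<lambda>x. x - 1)"])
      fix l assume l: "l \<in> {l \<in> bounded_lists d n. 0 \<notin> set l}"
      then show "map Suc (map (\<lambda>x. x - 1) l) = l"
        using pos by auto
      then have "sum_list l = sum_list (map (\<lambda>x. x - 1) l) + length l"
        using sum_Suc [of "map (\<lambda>x. x - 1) l"] by simp
      then show "map (\<lambda>x. x - 1) l \<in> bounded_lists d (n - d)"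
          "n - d - sum_list (map (\<lambda>x. x - 1) l) = n - sum_list l"
        using l by (auto simp: bounded_lists_def)
    qed (use True sum_Suc in \<open>auto simp: bounded_lists_def comp_def\<close>)
    then show ?thesis
      using sum_slack_bounded_lists [of "n - d" d] True by simp
  next
    case False
    have "{l \<in> bounded_lists d n. 0 \<notin> set l} = {}"
    proof -
      have "length l \<le> sum_list l" if "0 \<notin> set l" for l :: "nat list"
        using that by (induction l) auto
      then show ?thesis
        using False by (fastforce simp: bounded_lists_def)
    qed
    moreover have "n choose (Suc d) = 0"
      using False by (intro binomial_eq_0) auto
    ultimately show ?thesis by (simp only: sum.empty)
  qed
qed

text \<open>A list with least entry 0 represents its translates along \<open>(1, ..., 1)\<close>;
  their total slack is that of all lists less that of the positive ones.\<close>

lemma sum_slack_zero_lists: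
  "(\<Sum>l\<in>{l \<in> bounded_lists d n. 0 \<in> set l}. n - sum_list l) + (n choose (Suc d))
     = (n + d) choose (Suc d)"
proof -
  have "bounded_lists d n = {l \<in> bounded_lists d n. 0 \<in> set l} \<union> {l \<in> bounded_lists d n. 0 \<notin> set l}"
    by auto
  then have "(\<Sum>l\<in>bounded_lists d n. n - sum_list l)
     = (\<Sum>l\<in>{l \<in> bounded_lists d n. 0 \<in> set l}. n - sum_list l)
       + (\<Sum>l\<in>{l \<in> bounded_lists d n. 0 \<notin> set l}. n - sum_list l)"
    by (metis (mono_tags, lifting) sum.union_disjoint[of "{l \<in> bounded_lists d n. 0 \<in> set l}" "{l \<in> bounded_lists d n. 0 \<notin> set l}"] Int_Collect Int_emptyI finite_Un finite_bounded_lists mem_Collect_eq)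
  then show ?thesis
    by (simp add: sum_slack_bounded_lists sum_slack_positive_lists)
qed

text \<open>The integer points of the \<open>n\<close>-th dilate of the simplex. The inequalities
  are the barycentric coordinates, multiplied by \<open>1 + d * m\<close> and by the scale
  \<open>n\<close> so that they stay integral; the one with \<open>sum_list l\<close> belongs to the
  apex, the others to the unit vectors.\<close>

definition simplex_lists :: "nat \<Rightarrow> nat \<Rightarrow> nat \<Rightarrow> int list set" where
  "simplex_lists d m n = {l. length l = d \<and> sum_list l \<le> int n \<and>
     (\<forall>x\<in>set l. 0 \<le> (1 + int d * int m) * x + int m * (int n - sum_list l))}"

section \<open>Counting the points of the dilated simplex by their least coordinate\<close>

lemma sum_list_shift: "sum_list (map (\<lambda>y. int y - c) l) = int (sum_list l) - int (length l) * c"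
  by (induction l) (auto simp: algebra_simps)

text \<open>A point \<open>x\<close> with a negative coordinate is recorded by \<open>c = - min x\<close> and the list \<open>x + c\<close>,
  which contains \<open>0\<close>; the inequalities then say \<open>c \<le> m * (n - sum_list (x + c))\<close>.\<close>

lemma simplex_lists_eq:
  "simplex_lists d m n = map int ` bounded_lists d n \<union>
     (\<lambda>(l, c). map (\<lambda>y. int y - int c) l) `
       (SIGMA l:{l \<in> bounded_lists d n. 0 \<in> set l}. {1..m * (n - sum_list l)})"
    (is "_ = ?A \<union> ?f ` ?B")
proof (intro equalityI subsetI)
  fix x assume x: "x \<in> simplex_lists d m n"
  show "x \<in> ?A \<union> ?f ` ?B"
  proof (cases "\<forall>t\<in>set x. 0 \<le> t")
    case True
    then have eq: "x = map int (map nat x)"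
      by (induction x) auto
    then have "sum_list x = int (sum_list (map nat x))"
      by (metis sum_list_of_nat)
    then have "map nat x \<in> bounded_lists d n"
      using x by (auto simp: bounded_lists_def simplex_lists_def)
    then show ?thesis
      using eq by blast
  next
    case False
    then have ne: "set x \<noteq> {}" by auto
    define c where "c = nat (- Min (set x))"
    have neg: "Min (set x) < 0"
      using False by (metis List.finite_set Min_le linorder_not_le order_le_less_trans)
    then have c: "int c = - Min (set x)" "c \<ge> 1"
      by (auto simp: c_def)
    define l where "l = map (\<lambda>t. nat (t + int c)) x"
    have ge: "t + int c \<ge> 0" if "t \<in> set x" for t
      using that c by simp
    have xl: "x = map (\<lambda>y. int y - int c) l"
      using ge by (auto simp: l_def intro!: map_idI [symmetric])
    have "Min (set x) \<in> set x"
      using ne by simp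
    then have "nat (Min (set x) + int c) \<in> set l"
      unfolding l_def set_map by blast
    then have zero: "0 \<in> set l"
      using c by simp
    have len: "length l = d"
      using x by (simp add: l_def simplex_lists_def)
    have sum: "sum_list x = int (sum_list l) - int d * int c"
      by (subst xl) (simp add: sum_list_shift len)
    have "0 \<le> (1 + int d * int m) * Min (set x) + int m * (int n - sum_list x)"
      using x ne by (simp add: simplex_lists_def)
    also have "\<dots> = int m * (int n - int (sum_list l)) - int c"
      using c(1) by (simp add: sum algebra_simps)
    finally have le: "int c \<le> int m * (int n - int (sum_list l))"
      by simp
    then have "0 < int m * (int n - int (sum_list l))"
      using c(2) by linarith
    \<comment> \<open>Because \<open>c \<ge> 1\<close>, the slack is strictly positive, so the
      natural subtraction in the range of \<open>c\<close> does not truncate.\<close>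
    then have sl: "sum_list l < n"
      by (simp add: zero_less_mult_iff)
    then have "int c \<le> int (m * (n - sum_list l))"
      using le by (simp add: of_nat_diff)
    then have "c \<le> m * (n - sum_list l)"
      by (simp only: of_nat_le_iff)
    then have "(l, c) \<in> ?B"
      using zero len sl c(2) by (auto simp: bounded_lists_def)
    then show ?thesis
      using xl by force
  qed
next
  fix x assume "x \<in> ?A \<union> ?f ` ?B"
  then show "x \<in> simplex_lists d m n"
  proof
    assume "x \<in> ?A"
    then obtain l where l: "x = map int l" "l \<in> bounded_lists d n" by blast
    then have "sum_list x = int (sum_list l)" by (simp add: sum_list_of_nat)
    then show ?thesis
      using l by (auto simp: bounded_lists_def simplex_lists_def)
  next
    assume "x \<in> ?f ` ?B"
    then obtain l c where x: "x = map (\<lambda>y. int y - int c) l" and len: "length l = d"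
      and sl: "sum_list l \<le> n" and c: "1 \<le> c" "c \<le> m * (n - sum_list l)"
      by (auto simp: bounded_lists_def)
    have sum: "sum_list x = int (sum_list l) - int d * int c"
      by (simp add: x sum_list_shift len)
    have "int c \<le> int (m * (n - sum_list l))"
      using c(2) by (simp only: of_nat_le_iff)
    then have le: "int c \<le> int m * (int n - int (sum_list l))"
      using sl by (simp add: of_nat_diff)
    have "sum_list x \<le> int n"
      using sl unfolding sum by (smt (verit) of_nat_0_le_iff of_nat_le_iff mult_nonneg_nonneg)
    moreover have "0 \<le> (1 + int d * int m) * t + int m * (int n - sum_list x)" if t_in: "t \<in> set x" for t
    proof -
      obtain y where t: "t = int y - int c"
        using t_in unfolding x set_map by blast
      have "(1 + int d * int m) * t + int m * (int n - sum_list x)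
          = (1 + int d * int m) * int y + (int m * (int n - int (sum_list l)) - int c)"
        by (simp add: sum t algebra_simps)
      also have "\<dots> \<ge> 0"
        using le by simp
      finally show ?thesis .
    qed
    ultimately show ?thesis
      using len by (simp add: simplex_lists_def x)
  qed
qed

text \<open>The two sets are disjoint because \<open>c \<ge> 1\<close> produces a negative entry,
  and \<open>(l, c)\<close> can be recovered because the least entry of the image is
  \<open>- c\<close>. The subtracted binomial stands on the left to keep the identity in the natural
  numbers.\<close>

lemma card_simplex_lists:
  "card (simplex_lists d m n) + m * (n choose Suc d)
     = ((n + d) choose d) + m * ((n + d) choose Suc d)"
proof -
  let ?Y = "{l \<in> bounded_lists d n. 0 \<in> set l}"
  let ?f = "\<lambda>(l, c). map (\<lambda>y. int y - int c) l"
  let ?B = "SIGMA l:?Y. {1..m * (n - sum_list l)}"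
  have inj: "inj_on ?f ?B"
  proof (rule inj_onI)
    fix p q assume pq: "p \<in> ?B" "q \<in> ?B" "?f p = ?f q"
    obtain l c l' c' where p: "p = (l, c)" and q: "q = (l', c')" by (cases p, cases q)
    have min: "Min (set (?f (l, c))) = - int c" if "0 \<in> set l" for l c
      using that by (intro Min_eqI) force+
    then have c: "c = c'"
      using pq p q by (metis (no_types, lifting) mem_Collect_eq mem_Sigma_iff of_nat_eq_iff neg_equal_iff_equal)
    have "map (\<lambda>y. nat (y + int c)) (?f (l, c)) = l" for l c
      by (simp add: comp_def)
    then show "p = q"
      using pq(3) c p q by metis
  qed
  have disj: "map int ` bounded_lists d n \<inter> ?f ` ?B = {}"
  proof -
    have "x \<notin> map int ` bounded_lists d n" if x_in: "x \<in> ?f ` ?B" for x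
    proof -
      obtain l c where "x = map (\<lambda>y. int y - int c) l" "0 \<in> set l" "1 \<le> c"
        using x_in by auto
      then have "- int c \<in> set x" "- int c < 0" by force+
      then show ?thesis by force
    qed
    then show ?thesis by blast
  qed
  have "card (simplex_lists d m n) = card (map int ` bounded_lists d n) + card (?f ` ?B)"
    unfolding simplex_lists_eq by (rule card_Un_disjoint) (use disj in auto)
  also have "card (map int ` bounded_lists d n) = (n + d) choose d"
    by (subst card_image) (auto simp: card_bounded_lists inj_on_def inj_map_eq_map)
  also have "card (?f ` ?B) = (\<Sum>l\<in>?Y. m * (n - sum_list l))"
    by (subst card_image [OF inj]) (simp)
  also have "\<dots> = m * (\<Sum>l\<in>?Y. n - sum_list l)"
    by (simp add: sum_distrib_left)
  finally show ?thesis
    using sum_slack_zero_lists [of n d] by (metis (no_types, lifting) add.assoc distrib_left)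
qed

subsection \<open>The Ehrhart polynomial of the skew simplex\<close>

definition rising_poly :: "nat \<Rightarrow> real poly" where
  "rising_poly d = (\<Prod>i=1..d. [:real i, 1:])"

definition falling_poly :: "nat \<Rightarrow> real poly" where
  "falling_poly d = (\<Prod>i=1..d. [:- real i, 1:])"

text \<open>This is \<open>C(n + d, d + 1) - C(n, d + 1)\<close>: times \<open>fact (Suc d)\<close>,
  both binomials are products of \<open>d + 1\<close> consecutive factors containing
  \<open>n\<close>, and \<open>pCons 0\<close> restores that common factor.\<close>

definition simplex_growth_poly :: "nat \<Rightarrow> real poly" where
  "simplex_growth_poly d = smult (1 / fact (Suc d)) (pCons 0 (rising_poly d - falling_poly d))"

definition simplex_poly :: "nat \<Rightarrow> nat \<Rightarrow> real poly" where
  "simplex_poly d m = smult (1 / fact d) (rising_poly d) + smult (real m) (simplex_growth_poly d)"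

lemma rising_poly_Suc: "rising_poly (Suc d) = smult (real (Suc d)) (rising_poly d) + pCons 0 (rising_poly d)"
  by (simp add: rising_poly_def prod.nat_ivl_Suc' mult_pCons_left)

lemma falling_poly_Suc: "falling_poly (Suc d) = smult (- real (Suc d)) (falling_poly d) + pCons 0 (falling_poly d)"
  by (simp add: falling_poly_def prod.nat_ivl_Suc' mult_pCons_left)

lemma coeff_rising_poly_nonneg: "coeff (rising_poly d) j \<ge> 0"
proof (induction d arbitrary: j)
  case 0
  show ?case by (simp add: rising_poly_def coeff_pCons split: nat.split)
next
  case (Suc d)
  then show ?case by (simp add: rising_poly_Suc coeff_pCons split: nat.split)
qed

lemma coeff_rising_poly_pos: "j \<le> d \<Longrightarrow> coeff (rising_poly d) j > 0"
proof (induction d arbitrary: j)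
  case 0
  then show ?case by (simp add: rising_poly_def)
next
  case (Suc d)
  show ?case
  proof (cases j)
    case 0
    then show ?thesis using Suc.IH [of 0] by (simp add: rising_poly_Suc)
  next
    case (Suc i)
    then have "coeff (rising_poly d) i > 0"
      using Suc.IH [of i] Suc.prems by simp
    then show ?thesis
      using Suc coeff_rising_poly_nonneg [of d j]
      by (simp add: rising_poly_Suc add_nonneg_pos)
  qed
qed

lemma coeff_rising_poly_eq_0: "d < j \<Longrightarrow> coeff (rising_poly d) j = 0"
proof (induction d arbitrary: j)
  case 0
  then show ?case by (simp add: rising_poly_def coeff_pCons split: nat.split)
next
  case (Suc d)
  then show ?case by (simp add: rising_poly_Suc coeff_pCons split: nat.split)
qed

text \<open>Up to the sign \<open>(-1) ^ d\<close>, \<open>falling_poly d\<close> is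
  \<open>rising_poly d\<close> at the negated variable. In the difference of the two, coefficients
  with \<open>d + j\<close> odd double and the others cancel; the extra factor \<open>n\<close> then
  shifts the surviving degrees to the parity of \<open>d\<close>.\<close>

lemma coeff_falling_poly: "coeff (falling_poly d) j = (-1) ^ (d + j) * coeff (rising_poly d) j"
proof (induction d arbitrary: j)
  case 0
  show ?case by (cases j) (simp_all add: rising_poly_def falling_poly_def)
next
  case (Suc d)
  show ?case
    by (cases j) (simp_all add: rising_poly_Suc falling_poly_Suc Suc.IH algebra_simps)
qed

lemma poly_rising_poly: "poly (rising_poly d) (real n) = fact d * real ((n + d) choose d)"
proof (induction d)
  case 0
  show ?case by (simp add: rising_poly_def)
next
  case (Suc d)
  have "Suc d * (Suc (n + d) choose Suc d) = Suc (n + d) * ((n + d) choose d)"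
    by (rule Suc_times_binomial)
  then have "real (Suc d) * real (Suc (n + d) choose Suc d) = real (Suc (n + d)) * real ((n + d) choose d)"
    by (metis of_nat_mult)
  moreover have "poly (rising_poly (Suc d)) (real n) = real (Suc (n + d)) * poly (rising_poly d) (real n)"
    by (simp add: rising_poly_Suc algebra_simps)
  ultimately show ?case
    unfolding Suc.IH fact_Suc of_nat_mult add_Suc_right by (metis mult.assoc mult.commute)
qed

lemma rising_poly_times: "real n * poly (rising_poly d) (real n) = fact (Suc d) * real ((n + d) choose Suc d)"
proof -
  have "real (n + d) * real ((n + d) choose d)
      = real d * real ((n + d) choose d) + real (Suc d) * real ((n + d) choose Suc d)"
    unfolding binomial_gbinomial by (rule gbinomial_mult_1)
  then have "real n * real ((n + d) choose d) = real (Suc d) * real ((n + d) choose Suc d)"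
    by (simp add: algebra_simps)
  then show ?thesis
    unfolding poly_rising_poly fact_Suc by (simp add: algebra_simps)
qed

lemma falling_poly_times: "real n * poly (falling_poly d) (real n) = fact (Suc d) * real (n choose Suc d)"
proof -
  have "real n * poly (falling_poly d) (real n) = (\<Prod>i=0..<Suc d. real n - real i)"
  proof (induction d)
    case 0
    show ?case by (simp add: falling_poly_def)
  next
    case (Suc d)
    have "real n * poly (falling_poly (Suc d)) (real n)
        = (real n * poly (falling_poly d) (real n)) * (real n - real (Suc d))"
      by (simp add: falling_poly_Suc algebra_simps)
    then show ?case
      unfolding Suc.IH by (simp add: prod.atLeastLessThan_Suc)
  qed
  also have "\<dots> = fact (Suc d) * real (n choose Suc d)"
    unfolding binomial_gbinomial gbinomial_prod_rev by simp
  finally show ?thesis .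
qed

lemma poly_simplex_poly:
  "poly (simplex_poly d m) (real n) = real (card (simplex_lists d m n))"
proof -
  have "real (card (simplex_lists d m n) + m * (n choose Suc d))
     = real (((n + d) choose d) + m * ((n + d) choose Suc d))"
    by (simp only: card_simplex_lists)
  then have "real (card (simplex_lists d m n))
     = real ((n + d) choose d) + real m * (real ((n + d) choose Suc d) - real (n choose Suc d))"
    by (simp add: algebra_simps)
  also have "real ((n + d) choose Suc d) - real (n choose Suc d) = poly (simplex_growth_poly d) (real n)"
    by (simp add: simplex_growth_poly_def right_diff_distrib rising_poly_times falling_poly_times
        diff_divide_distrib del: fact_Suc)
  finally show ?thesis
    by (simp add: simplex_poly_def poly_rising_poly)
qed

lemma coeff_simplex_growth_poly_Suc:
  "coeff (simplex_growth_poly d) (Suc j) = (1 - (-1) ^ (d + j)) * coeff (rising_poly d) j / fact (Suc d)"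
  by (simp add: simplex_growth_poly_def coeff_falling_poly left_diff_distrib del: fact_Suc)

lemma coeff_simplex_growth_poly_nonneg: "coeff (simplex_growth_poly d) j \<ge> 0"
proof (cases j)
  case 0
  then show ?thesis by (simp add: simplex_growth_poly_def)
next
  case (Suc i)
  have "(1::real) - (-1) ^ (d + i) \<ge> 0"
    by (cases "even (d + i)") simp_all
  then show ?thesis
    unfolding Suc coeff_simplex_growth_poly_Suc by (simp add: coeff_rising_poly_nonneg del: fact_Suc)
qed

lemma coeff_simplex_growth_poly_odd: "odd (d + j) \<Longrightarrow> coeff (simplex_growth_poly d) j = 0"
  by (cases j) (simp_all add: simplex_growth_poly_def coeff_simplex_growth_poly_Suc coeff_falling_poly del: fact_Suc)

text \<open>Both products are monic of degree \<open>d\<close>, so the term of degree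
  \<open>d + 1\<close> cancels; this is what keeps the degree of the count equal to the
  dimension.\<close>

lemma coeff_simplex_growth_poly_eq_0: "d < j \<Longrightarrow> coeff (simplex_growth_poly d) j = 0"
proof (cases j)
  case (Suc i)
  moreover assume "d < j"
  ultimately consider "i = d" | "d < i" by linarith
  then show ?thesis
    by cases (simp_all add: Suc coeff_simplex_growth_poly_Suc coeff_rising_poly_eq_0)
qed simp

text \<open>Here \<open>d \<ge> 3\<close> makes \<open>d - 2\<close> a successor: the degree has the
  parity of \<open>d\<close> and is not 0, where the coefficient would vanish.\<close>

lemma coeff_simplex_growth_poly_pos:
  assumes "d \<ge> 3"
  shows "coeff (simplex_growth_poly d) (d - 2) > 0"
proof -
  obtain i where d: "d = i + 3"
    using assms by (metis add.commute le_Suc_ex)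
  have "coeff (simplex_growth_poly d) (Suc i) > 0"
    unfolding coeff_simplex_growth_poly_Suc using coeff_rising_poly_pos [of i d]
    by (simp add: d)
  then show ?thesis by (simp add: d)
qed

lemma coeff_simplex_poly_pos: "j \<le> d \<Longrightarrow> coeff (simplex_poly d m) j > 0"
  using coeff_rising_poly_pos [of j d] coeff_simplex_growth_poly_nonneg [of d j]
  by (simp add: simplex_poly_def add_pos_nonneg)

lemma degree_simplex_poly: "degree (simplex_poly d m) = d"
proof (rule antisym)
  show "degree (simplex_poly d m) \<le> d"
    by (rule degree_le) (simp add: simplex_poly_def coeff_rising_poly_eq_0 coeff_simplex_growth_poly_eq_0)
  show "d \<le> degree (simplex_poly d m)"
    using coeff_simplex_poly_pos [of d d m] by (intro le_degree) simp
qed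

section \<open>Extracting the coefficient \<open>a (d - 1)\<close> of the magic expansion\<close>

text \<open>For \<open>g = \<Sum> a i * x ^ i * (x + 1) ^ (d - i)\<close> the sum below is \<open>a (d - 1)\<close>,
  because \<open>(-1) ^ (d + 1) * (g' (-1) + d * g (-1))\<close> only sees the term \<open>i = d - 1\<close>.\<close>

lemma magic_positive_alternating_sum:
  assumes "magic_positive g" and d: "degree g = d"
  shows "(\<Sum>j\<le>d. coeff g j * ((-1) ^ (d + 1 + j) * (real d - real j))) \<ge> 0"
proof -
  define D :: "real poly \<Rightarrow> real"
    where "D p = (-1) ^ (d + 1) * (poly (pderiv p) (-1) + real d * poly p (-1))" for p
  have D_sum: "D (\<Sum>i\<in>A. f i) = (\<Sum>i\<in>A. D (f i))" for f and A :: "nat set"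
    by (induction A rule: infinite_finite_induct) (simp_all add: D_def pderiv_add algebra_simps)
  have D_smult: "D (smult c p) = c * D p" for c p
    by (simp add: D_def pderiv_smult algebra_simps)
  have D_monom: "D (monom c j) = c * ((-1) ^ (d + 1 + j) * (real d - real j))" for c j
    by (cases j) (simp_all add: D_def pderiv_monom poly_monom power_add algebra_simps)
  obtain a where a: "\<And>i. i \<le> d \<Longrightarrow> a i \<ge> 0"
    and g: "g = (\<Sum>i \<le> d. smult (a i) ([:0, 1:] ^ i * [:1, 1:] ^ (d - i)))"
    using assms unfolding magic_positive_def by blast
  have "D ([:0, 1:] ^ i * [:1, 1:] ^ (d - i)) \<ge> 0" if i: "i \<le> d" for i
  proof -
    \<comment> \<open>\<open>D\<close> vanishes for \<open>i = d\<close> because its two summands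
      cancel, equals 1 for \<open>i = d - 1\<close>, and vanishes for smaller \<open>i\<close>
      because -1 is then a double root.\<close>
    consider "i = d" | "d = Suc i" | e where "d = Suc (Suc e) + i"
      using i by (metis add.commute le_Suc_ex not0_implies_Suc add_Suc add_0)
    then show ?thesis
    proof cases
      case 1
      then show ?thesis
        using D_monom [of 1 d] by (simp add: monom_altdef)
    next
      case 2
      then show ?thesis
        by (simp add: D_def pderiv_mult pderiv_pCons del: mult_pCons_right)
    next
      case 3
      then have "d - i = Suc (Suc e)" by simp
      then show ?thesis
        by (simp only:) (simp add: D_def pderiv_mult pderiv_power_Suc del: power_Suc)
    qed
  qed
  then have "0 \<le> D g"
    unfolding g D_sum D_smult using a by (intro sum_nonneg mult_nonneg_nonneg) auto
  also have "D g = D (\<Sum>j\<le>d. monom (coeff g j) j)"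
    by (simp add: poly_as_sum_of_monoms' d)
  finally show ?thesis
    by (simp add: D_sum D_monom)
qed

lemma ex_not_magic_positive_simplex_poly:
  assumes "d \<ge> 3" "k \<ge> 1"
  shows "\<exists>m. \<not> magic_positive (simplex_poly d m \<circ>\<^sub>p [:0, real k:])"
proof -
  \<comment> \<open>\<open>w j\<close> is the weight with which the coefficient of degree
    \<open>j\<close> before dilation enters \<open>a (d - 1)\<close> after dilation by
    \<open>k\<close>. Hence \<open>a (d - 1) = \<alpha> + m * \<beta>\<close>, and it remains to see
    that \<open>\<beta>\<close> is negative.\<close>
  define w where "w j = real k ^ j * ((-1) ^ (d + 1 + j) * (real d - real j))" for j
  define \<alpha> where "\<alpha> = (\<Sum>j\<le>d. coeff (smult (1 / fact d) (rising_poly d)) j * w j)"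
  define \<beta> where "\<beta> = (\<Sum>j\<le>d. coeff (simplex_growth_poly d) j * w j)"
  have "(\<Sum>j\<le>d. coeff (simplex_growth_poly d) j * w j) < (\<Sum>j\<le>d. 0)"
  proof (rule sum_strict_mono_ex1)
    show "\<forall>j\<in>{..d}. coeff (simplex_growth_poly d) j * w j \<le> 0"
    proof
      fix j assume "j \<in> {..d}"
      show "coeff (simplex_growth_poly d) j * w j \<le> 0"
      proof (cases "odd (d + j)")
        case True
        then show ?thesis by (simp add: coeff_simplex_growth_poly_odd)
      next
        case False
        then have "w j \<le> 0"
          using \<open>j \<in> {..d}\<close> by (simp add: w_def mult_nonneg_nonpos)
        then show ?thesis
          using coeff_simplex_growth_poly_nonneg by (simp add: mult_nonneg_nonpos)
      qed
    qed
    have "w (d - 2) < 0"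
      using assms by (simp add: w_def)
    then have "coeff (simplex_growth_poly d) (d - 2) * w (d - 2) < 0"
      using coeff_simplex_growth_poly_pos [OF assms(1)] by (simp add: mult_pos_neg)
    then show "\<exists>j\<in>{..d}. coeff (simplex_growth_poly d) j * w j < 0"
      by (intro bexI [of _ "d - 2"]) auto
  qed simp
  then have "\<beta> < 0" by (simp add: \<beta>_def)
  obtain m :: nat where "real m > \<alpha> / - \<beta>"
    using reals_Archimedean2 by blast
  then have neg: "\<alpha> + real m * \<beta> < 0"
    using \<open>\<beta> < 0\<close> by (simp add: field_simps)
  have "\<not> magic_positive (simplex_poly d m \<circ>\<^sub>p [:0, real k:])"
  proof
    assume magic: "magic_positive (simplex_poly d m \<circ>\<^sub>p [:0, real k:])"
    have "degree (simplex_poly d m \<circ>\<^sub>p [:0, real k:]) = d"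
      using assms by (simp add: degree_pcompose degree_simplex_poly)
    from magic_positive_alternating_sum [OF magic this]
    have "0 \<le> (\<Sum>j\<le>d. coeff (simplex_poly d m) j * w j)"
      by (simp add: coeff_pcompose_linear w_def mult_ac)
    also have "\<dots> = \<alpha> + real m * \<beta>"
      by (simp add: \<alpha>_def \<beta>_def simplex_poly_def distrib_right sum.distrib sum_distrib_left mult.assoc)
    finally show False using neg by simp
  qed
  then show ?thesis ..
qed

subsection \<open>The skew simplex\<close>

abbreviation unit_point :: "nat \<Rightarrow> nat \<Rightarrow>\<^sub>0 real" where
  "unit_point i \<equiv> Poly_Mapping.single i 1"

definition apex_point :: "nat \<Rightarrow> nat \<Rightarrow> nat \<Rightarrow>\<^sub>0 real" where
  "apex_point d m = (- real m) *\<^sub>R (\<Sum>i<d. unit_point i)"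

definition skew_simplex :: "nat \<Rightarrow> nat \<Rightarrow> (nat \<Rightarrow>\<^sub>0 real) set" where
  "skew_simplex d m = convex hull (insert (apex_point d m) (unit_point ` {..<d}))"

abbreviation coord_sum :: "nat \<Rightarrow> (nat \<Rightarrow>\<^sub>0 real) \<Rightarrow> real" where
  "coord_sum d x \<equiv> (\<Sum>i<d. Poly_Mapping.lookup x i)"

text \<open>The facet description of the simplex scaled by \<open>t\<close>, over the reals: the
  same scaled barycentric coordinates as in \<open>simplex_lists\<close>.\<close>

definition skew_region :: "nat \<Rightarrow> nat \<Rightarrow> real \<Rightarrow> (nat \<Rightarrow>\<^sub>0 real) set" where
  "skew_region d m t = {x. Poly_Mapping.keys x \<subseteq> {..<d} \<and> coord_sum d x \<le> t \<and>
     (\<forall>i<d. 0 \<le> (1 + real d * real m) * Poly_Mapping.lookup x i + real m * (t - coord_sum d x))}"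

lemma keys_subset_iff: "Poly_Mapping.keys x \<subseteq> A \<longleftrightarrow> (\<forall>i. i \<notin> A \<longrightarrow> Poly_Mapping.lookup x i = 0)"
  by (auto simp: in_keys_iff)

lemma lookup_apex_point: "Poly_Mapping.lookup (apex_point d m) i = (if i < d then - real m else 0)"
  by (simp add: apex_point_def lookup_single when_def)

lemma coord_sum_unit_point: "i < d \<Longrightarrow> coord_sum d (unit_point i) = 1"
  by (simp add: lookup_single when_def)

lemma coord_sum_apex_point: "coord_sum d (apex_point d m) = - real d * real m"
  by (simp add: lookup_apex_point)

lemma convex_skew_region: "convex (skew_region d m t)"
proof (rule convexI)
  fix x y :: "nat \<Rightarrow>\<^sub>0 real" and u v :: real
  assume x: "x \<in> skew_region d m t" and y: "y \<in> skew_region d m t"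
    and uv: "u \<ge> 0" "v \<ge> 0" "u + v = 1"
  have cs: "coord_sum d (u *\<^sub>R x + v *\<^sub>R y) = u * coord_sum d x + v * coord_sum d y"
    by (simp add: lookup_add sum.distrib sum_distrib_left)
  have "u * coord_sum d x + v * coord_sum d y \<le> u * t + v * t"
    using x y uv by (intro add_mono mult_left_mono) (auto simp: skew_region_def)
  also have "\<dots> = t"
    using uv by (metis distrib_right mult_1)
  finally have "coord_sum d (u *\<^sub>R x + v *\<^sub>R y) \<le> t"
    using cs by simp
  moreover have "0 \<le> (1 + real d * real m) * Poly_Mapping.lookup (u *\<^sub>R x + v *\<^sub>R y) i
       + real m * (t - coord_sum d (u *\<^sub>R x + v *\<^sub>R y))" if "i < d" for i
  proof -
    let ?f = "\<lambda>z. (1 + real d * real m) * Poly_Mapping.lookup z i + real m * (t - coord_sum d z)"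
    have "0 \<le> ?f x" "0 \<le> ?f y"
      using x y that by (auto simp: skew_region_def)
    then have "0 \<le> u * ?f x + v * ?f y"
      using uv by (metis add_nonneg_nonneg mult_nonneg_nonneg)
    also have "\<dots> = (1 + real d * real m) * (u * Poly_Mapping.lookup x i + v * Poly_Mapping.lookup y i)
        + real m * ((u + v) * t - (u * coord_sum d x + v * coord_sum d y))"
      by (simp add: algebra_simps)
    finally show ?thesis
      using uv unfolding cs by (simp add: lookup_add)
  qed
  ultimately show "u *\<^sub>R x + v *\<^sub>R y \<in> skew_region d m t"
    using x y by (auto simp: skew_region_def keys_subset_iff lookup_add)
qed

lemma skew_simplex_eq: "skew_simplex d m = skew_region d m 1"
proof
  show "skew_simplex d m \<subseteq> skew_region d m 1"
    unfolding skew_simplex_def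
  proof (rule hull_minimal)
    have "apex_point d m \<in> skew_region d m 1"
      by (simp add: skew_region_def coord_sum_apex_point lookup_apex_point keys_subset_iff del: sum_constant)
         (simp add: algebra_simps order.trans [of "-1" 0])
    moreover have "unit_point i \<in> skew_region d m 1" if "i < d" for i
      using that by (simp add: skew_region_def coord_sum_unit_point) (simp add: lookup_single when_def)
    ultimately show "insert (apex_point d m) (unit_point ` {..<d}) \<subseteq> skew_region d m 1"
      by auto
  qed (rule convex_skew_region)
  show "skew_region d m 1 \<subseteq> skew_simplex d m"
  proof
    fix x assume x: "x \<in> skew_region d m 1"
    define D where "D = 1 + real d * real m"
    have D: "D > 0" by (simp add: D_def add_pos_nonneg)
    \<comment> \<open>The barycentric coordinates of \<open>x\<close> are forced: comparing
      coordinates gives \<open>c i = x_i + m * a\<close> with \<open>a\<close> the weight of the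
      apex, and total weight 1 gives \<open>coord_sum d x + (1 + d * m) * a = 1\<close>. The apex
      gets index \<open>d\<close>.\<close>
    define a where "a = (1 - coord_sum d x) / D"
    define c where "c i = (if i < d then Poly_Mapping.lookup x i + real m * a else a)" for i
    define y where "y i = (if i < d then unit_point i else apex_point d m)" for i
    have "(\<Sum>i<Suc d. c i) = coord_sum d x + D * a"
      by (simp add: c_def sum.distrib D_def algebra_simps)
    also have "\<dots> = 1"
      using D by (simp add: a_def)
    finally have sum1: "(\<Sum>i<Suc d. c i) = 1" .
    have nonneg: "c i \<ge> 0" for i
    proof (cases "i < d")
      case True
      then have "0 \<le> D * Poly_Mapping.lookup x i + real m * (1 - coord_sum d x)"
        using x by (simp add: skew_region_def D_def)
      also have "\<dots> = D * c i"
        using D True by (simp add: c_def a_def field_simps)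
      finally show ?thesis
        using D by (simp add: zero_le_mult_iff)
    next
      case False
      then show ?thesis
        using x D by (simp add: c_def a_def skew_region_def)
    qed
    have "(\<Sum>i<Suc d. c i *\<^sub>R y i) \<in> skew_simplex d m"
      unfolding skew_simplex_def
    proof (rule convex_sum)
      show "y i \<in> convex hull insert (apex_point d m) (unit_point ` {..<d})" for i
        by (rule hull_inc) (auto simp: y_def)
    qed (use sum1 nonneg in \<open>auto simp: convex_convex_hull\<close>)
    also have "(\<Sum>i<Suc d. c i *\<^sub>R y i) = x"
    proof (rule poly_mapping_eqI)
      fix j
      have "Poly_Mapping.lookup (\<Sum>i<Suc d. c i *\<^sub>R y i) j
          = (\<Sum>i<d. c i * (if i = j then 1 else 0)) + a * (if j < d then - real m else 0)"
        by (simp add: lookup_add c_def y_def lookup_apex_point lookup_single when_def)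
      also have "(\<Sum>i<d. c i * (if i = j then 1 else 0)) = (if j < d then c j else 0)"
        by (simp add: sum.delta if_distrib [of "\<lambda>t. _ * t"] cong: if_cong)
      finally show "Poly_Mapping.lookup (\<Sum>i<Suc d. c i *\<^sub>R y i) j = Poly_Mapping.lookup x j"
        using x by (auto simp: c_def skew_region_def keys_subset_iff)
    qed
    finally show "x \<in> skew_simplex d m" .
  qed
qed

lemma dilate_skew_simplex:
  assumes "n > 0"
  shows "dilate n (skew_simplex d m) = skew_region d m (real n)"
proof -
  have scale: "real n *\<^sub>R x \<in> skew_region d m (real n) \<longleftrightarrow> x \<in> skew_region d m 1" for x
  proof -
    have "(1 + real d * real m) * (real n * Poly_Mapping.lookup x i) + real m * (real n - real n * coord_sum d x)
      = real n * ((1 + real d * real m) * Poly_Mapping.lookup x i + real m * (1 - coord_sum d x))" for i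
      by (simp add: algebra_simps)
    moreover have "coord_sum d (real n *\<^sub>R x) = real n * coord_sum d x"
      by (simp add: sum_distrib_left)
    ultimately show ?thesis
      using assms by (simp add: skew_region_def keys_subset_iff zero_le_mult_iff)
  qed
  show ?thesis
  proof (intro equalityI subsetI)
    fix x assume "x \<in> dilate n (skew_simplex d m)"
    then show "x \<in> skew_region d m (real n)"
      using scale by (auto simp: dilate_def skew_simplex_eq)
  next
    fix x assume x: "x \<in> skew_region d m (real n)"
    have eq: "x = real n *\<^sub>R ((1 / real n) *\<^sub>R x)"
      using assms by simp
    then have "(1 / real n) *\<^sub>R x \<in> skew_simplex d m"
      using x scale by (metis skew_simplex_eq)
    then show "x \<in> dilate n (skew_simplex d m)"
      using eq unfolding dilate_def by blast
  qed
qed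

text \<open>Transfers the count from integer lists to finitely supported functions. The embedding
  \<open>h\<close> forgets trailing zeros, so it is injective only on lists of a fixed
  length.\<close>

lemma card_dilate_skew_simplex:
  assumes "n > 0"
  shows "card (dilate n (skew_simplex d m) \<inter> int_lattice d) = card (simplex_lists d m n)"
proof -
  define h where "h l = Poly_Mapping.nth (map real_of_int l)" for l
  have lookup_h: "Poly_Mapping.lookup (h l) i = (if i < length l then real_of_int (l ! i) else 0)" for l i
    by (simp add: h_def nth_default_def)
  have coord_sum_h: "coord_sum d (h l) = real_of_int (sum_list l)" if "length l = d" for l
    using that by (simp add: lookup_h sum_list_sum_nth atLeast0LessThan)
  have region_h: "h l \<in> skew_region d m (real n) \<longleftrightarrow> l \<in> simplex_lists d m n" if len: "length l = d" for l
  proof -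
    have "(1 + real d * real m) * real_of_int x + real m * (real n - real_of_int (sum_list l))
       = real_of_int ((1 + int d * int m) * x + int m * (int n - sum_list l))" for x
      by simp
    then have "0 \<le> (1 + real d * real m) * real_of_int x + real m * (real n - real_of_int (sum_list l))
       \<longleftrightarrow> 0 \<le> (1 + int d * int m) * x + int m * (int n - sum_list l)" for x
      by (metis of_int_0_le_iff)
    moreover have "real_of_int (sum_list l) \<le> real n \<longleftrightarrow> sum_list l \<le> int n"
      by (metis of_int_le_iff of_int_of_nat_eq)
    moreover have "Poly_Mapping.keys (h l) \<subseteq> {..<d}"
      using len by (simp add: keys_subset_iff lookup_h)
    ultimately show ?thesis
      unfolding skew_region_def simplex_lists_def mem_Collect_eq coord_sum_h [OF len]
      using len by (simp add: lookup_h all_set_conv_all_nth)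
  qed
  have "inj_on h {l. length l = d}"
  proof (rule inj_onI)
    fix l l' assume "l \<in> {l. length l = d}" "l' \<in> {l. length l = d}" "h l = h l'"
    then show "l = l'"
      by (metis (mono_tags, lifting) lookup_h mem_Collect_eq nth_equalityI of_int_eq_iff)
  qed
  then have "inj_on h (simplex_lists d m n)"
    by (rule inj_on_subset) (auto simp: simplex_lists_def)
  moreover have "h ` simplex_lists d m n = dilate n (skew_simplex d m) \<inter> int_lattice d"
  proof (intro equalityI subsetI)
    fix x assume "x \<in> h ` simplex_lists d m n"
    then obtain l where "l \<in> simplex_lists d m n" "x = h l" "length l = d"
      by (auto simp: simplex_lists_def)
    then show "x \<in> dilate n (skew_simplex d m) \<inter> int_lattice d"
      using region_h by (auto simp: dilate_skew_simplex [OF assms] int_lattice_def keys_subset_iff lookup_h)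
  next
    fix x assume x: "x \<in> dilate n (skew_simplex d m) \<inter> int_lattice d"
    define l where "l = map (\<lambda>i. \<lfloor>Poly_Mapping.lookup x i\<rfloor>) [0..<d]"
    have "x = h l"
      using x by (intro poly_mapping_eqI)
        (auto simp: lookup_h l_def int_lattice_def keys_subset_iff elim: Ints_cases)
    moreover have "length l = d" by (simp add: l_def)
    ultimately show "x \<in> h ` simplex_lists d m n"
      using x region_h by (auto simp: dilate_skew_simplex [OF assms])
  qed
  ultimately show ?thesis
    by (metis card_image)
qed

lemma lattice_polytope_skew_simplex: "lattice_polytope d (skew_simplex d m)"
proof -
  have "insert (apex_point d m) (unit_point ` {..<d}) \<subseteq> int_lattice d"
    by (auto simp: int_lattice_def lookup_apex_point lookup_single keys_subset_iff when_def)
  then show ?thesis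
    unfolding lattice_polytope_def skew_simplex_def
    by (intro exI [of _ "insert (apex_point d m) (unit_point ` {..<d})"]) simp
qed

text \<open>The origin satisfies all facet inequalities, so it can serve as base point and the
  affine dimension becomes a linear one. The apex adds nothing to the span of the unit
  vectors.\<close>

lemma affine_dimension_skew_simplex: "affine_dimension (skew_simplex d m) = d"
proof -
  let ?E = "unit_point ` {..<d}"
  have inj: "inj_on unit_point {..<d}"
    by (rule inj_onI) (metis lookup_single_eq lookup_single_not_eq zero_neq_one)
  have zero: "0 \<in> skew_simplex d m"
    by (simp add: skew_simplex_eq skew_region_def)
  have E: "?E \<subseteq> skew_simplex d m"
    unfolding skew_simplex_def by (auto intro: hull_inc)
  have "affine_dimension (skew_simplex d m) = dim (skew_simplex d m)"
    using affine_dimension_eq_dim [OF zero refl] by simp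
  also have "\<dots> = dim ?E"
  proof (rule span_eq_dim)
    show "span (skew_simplex d m) = span ?E"
    proof (rule span_eq [THEN iffD2], intro conjI)
      have "skew_simplex d m \<subseteq> span ?E"
        unfolding skew_simplex_def
      proof (rule hull_minimal)
        have "apex_point d m \<in> span ?E"
          unfolding apex_point_def by (intro span_scale span_sum span_base) auto
        then show "insert (apex_point d m) ?E \<subseteq> span ?E"
          by (auto intro: span_base)
        show "convex (span ?E)"
          by (simp add: subspace_imp_convex)
      qed
      then show "skew_simplex d m \<subseteq> span ?E" .
      show "?E \<subseteq> span (skew_simplex d m)"
        using E span_superset by blast
    qed
  qed
  also have "\<dots> = card ?E"
  proof (rule dim_eq_card_independent)
    show "independent ?E"
      unfolding dependent_finite [OF finite_imageI [OF finite_lessThan]]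
    proof (clarsimp)
      fix u i assume sum: "(\<Sum>v\<in>?E. u v *\<^sub>R v) = 0" and i: "i < d" and nz: "u (unit_point i) \<noteq> 0"
      have "0 = Poly_Mapping.lookup (\<Sum>j<d. u (unit_point j) *\<^sub>R unit_point j) i"
        using sum by (simp add: sum.reindex [OF inj])
      also have "\<dots> = (\<Sum>j<d. if j = i then u (unit_point j) else 0)"
        unfolding lookup_sum_real by (rule sum.cong) (auto simp: lookup_single when_def)
      also have "\<dots> = u (unit_point i)"
        using i by simp
      finally show False using nz by simp
    qed
  qed
  also have "\<dots> = d"
    by (simp add: card_image [OF inj])
  finally show ?thesis .
qed

theorem ex_ehrhart_positive_not_magic_positive_dilate:
  assumes "d \<ge> 3" "k \<ge> 1"
  shows "\<exists>N P. lattice_polytope N P \<and> affine_dimension P = d \<and> ehrhart_positive N P \<and>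
    \<not> magic_positive (ehrhart_poly N (dilate k P))"
proof -
  obtain m where m: "\<not> magic_positive (simplex_poly d m \<circ>\<^sub>p [:0, real k:])"
    using ex_not_magic_positive_simplex_poly [OF assms] by blast
  have deg: "degree (simplex_poly d m) = affine_dimension (skew_simplex d m)"
    by (simp add: degree_simplex_poly affine_dimension_skew_simplex)
  have count: "poly (simplex_poly d m) (real n) = real (card (dilate n (skew_simplex d m) \<inter> int_lattice d))"
    if "n > 0" for n
    using that by (simp add: poly_simplex_poly card_dilate_skew_simplex)
  have "ehrhart_poly d (skew_simplex d m) = simplex_poly d m"
    by (rule ehrhart_poly_eqI [OF deg]) (rule count)
  then have "ehrhart_positive d (skew_simplex d m)"
    by (simp add: ehrhart_positive_def affine_dimension_skew_simplex coeff_simplex_poly_pos)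
  moreover have "ehrhart_poly d (dilate k (skew_simplex d m)) = simplex_poly d m \<circ>\<^sub>p [:0, real k:]"
    using ehrhart_poly_dilate [OF deg _ count] assms by simp
  ultimately show ?thesis
    using m lattice_polytope_skew_simplex affine_dimension_skew_simplex by metis
qed

subsection \<open>Lattice points of triangles\<close>

text \<open>The determinant, twice a signed area. The sign of \<open>cross2 (w - u) (p - u)\<close>
  tells on which side of the line through \<open>u\<close> and \<open>w\<close> the point
  \<open>p\<close> lies.\<close>

definition cross2 :: "real \<times> real \<Rightarrow> real \<times> real \<Rightarrow> real" where
  "cross2 a b = fst a * snd b - snd a * fst b"

lemma cross2_simps [simp]:
  "cross2 (a + b) c = cross2 a c + cross2 b c" "cross2 a (b + c) = cross2 a b + cross2 a c"
  "cross2 (a - b) c = cross2 a c - cross2 b c" "cross2 a (b - c) = cross2 a b - cross2 a c"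
  "cross2 (r *\<^sub>R a) c = r * cross2 a c" "cross2 a (r *\<^sub>R c) = r * cross2 a c"
  "cross2 a a = 0" "cross2 0 a = 0" "cross2 a 0 = 0" "cross2 (- a) b = - cross2 a b"
  "cross2 a (- b) = - cross2 a b"
  by (simp_all add: cross2_def algebra_simps)

lemma cross2_commute: "cross2 a b = - cross2 b a"
  by (simp add: cross2_def)

text \<open>Cramer's rule, cleared of denominators.\<close>

lemma cross2_decompose: "cross2 u v *\<^sub>R p = cross2 p v *\<^sub>R u + cross2 u p *\<^sub>R v"
  by (simp add: cross2_def prod_eq_iff algebra_simps)

lemma cross2_combination_eq_iff:
  assumes "cross2 u v \<noteq> 0"
  shows "x *\<^sub>R u + y *\<^sub>R v = x' *\<^sub>R u + y' *\<^sub>R v \<longleftrightarrow> x = x' \<and> y = y'"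
proof
  assume eq: "x *\<^sub>R u + y *\<^sub>R v = x' *\<^sub>R u + y' *\<^sub>R v"
  have "x * cross2 u v = cross2 (x *\<^sub>R u + y *\<^sub>R v) v" "y * cross2 u v = cross2 u (x *\<^sub>R u + y *\<^sub>R v)"
    by simp_all
  then show "x = x' \<and> y = y'"
    unfolding eq using assms by simp
qed simp

text \<open>A discrete subgroup of the plane. It will be the preimage of the integer lattice under a
  chart of the plane of the polygon, and that preimage depends on the chart.\<close>

locale planar_lattice =
  fixes L :: "(real \<times> real) set"
  assumes zero_in [simp]: "0 \<in> L"
    and add_in: "a \<in> L \<Longrightarrow> b \<in> L \<Longrightarrow> a + b \<in> L"
    and uminus_in: "a \<in> L \<Longrightarrow> - a \<in> L"
    and finite_bounded: "bounded B \<Longrightarrow> finite (B \<inter> L)"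
begin

lemma diff_in: "a \<in> L \<Longrightarrow> b \<in> L \<Longrightarrow> a - b \<in> L"
  using add_in [of a "- b"] uminus_in by simp

lemma nat_scale_in: "a \<in> L \<Longrightarrow> real n *\<^sub>R a \<in> L"
  by (induction n) (simp_all add: add_in scaleR_add_left)

lemma add_in_iff: "b \<in> L \<Longrightarrow> a + b \<in> L \<longleftrightarrow> a \<in> L" "b \<in> L \<Longrightarrow> b + a \<in> L \<longleftrightarrow> a \<in> L"
  using add_in diff_in by (metis add_diff_cancel_right' , metis add_diff_cancel_left')

lemma diff_in_iff: "b \<in> L \<Longrightarrow> b - a \<in> L \<longleftrightarrow> a \<in> L"
  using diff_in by (metis diff_diff_eq2 add_diff_cancel_left')

text \<open>For nonzero \<open>d\<close> in \<open>L\<close>, the number of primitive lattice steps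
  in \<open>d\<close> (the gcd of its coordinates for the standard lattice). The half-open range
  makes it additive along multiples of \<open>d\<close>.\<close>

definition lattice_length :: "real \<times> real \<Rightarrow> nat" where
  "lattice_length d = card {t. 0 \<le> t \<and> t < 1 \<and> t *\<^sub>R d \<in> L}"

lemma finite_multiples:
  assumes "d \<noteq> 0" "\<And>t. t \<in> T \<Longrightarrow> \<bar>t\<bar> \<le> r"
  shows "finite {t \<in> T. t *\<^sub>R d \<in> L}"
proof (rule finite_imageD)
  show "inj_on (\<lambda>t. t *\<^sub>R d) {t \<in> T. t *\<^sub>R d \<in> L}"
    using assms(1) by (auto simp: inj_on_def)
  have "bounded ((\<lambda>t. t *\<^sub>R d) ` T)"
  proof (rule boundedI)
    fix p assume "p \<in> (\<lambda>t. t *\<^sub>R d) ` T"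
    then obtain t where "t \<in> T" "p = t *\<^sub>R d" by blast
    then show "norm p \<le> r * norm d"
      using assms(2) by (simp add: mult_right_mono)
  qed
  then show "finite ((\<lambda>t. t *\<^sub>R d) ` {t \<in> T. t *\<^sub>R d \<in> L})"
    by (rule finite_subset [OF _ finite_bounded, rotated]) auto
qed

lemma finite_multiples_interval:
  assumes "d \<noteq> 0"
  shows "finite {t. 0 \<le> t \<and> t < r \<and> t *\<^sub>R d \<in> L}" "finite {t. 0 \<le> t \<and> t \<le> r \<and> t *\<^sub>R d \<in> L}"
    "finite {t. 0 < t \<and> t < r \<and> t *\<^sub>R d \<in> L}"
  using finite_multiples [OF assms, of "{0..<r}" "\<bar>r\<bar>"] finite_multiples [OF assms, of "{0..r}" "\<bar>r\<bar>"]
    finite_multiples [OF assms, of "{0<..<r}" "\<bar>r\<bar>"]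
  by (simp_all add: conj_assoc)

lemma card_multiples_half_open:
  assumes d: "d \<noteq> 0" "d \<in> L"
  shows "card {t. 0 \<le> t \<and> t < real n \<and> t *\<^sub>R d \<in> L} = n * lattice_length d"
proof (induction n)
  case 0
  have "{t. 0 \<le> t \<and> t < real 0 \<and> t *\<^sub>R d \<in> L} = {}" by auto
  then show ?case by (simp only: card.empty mult_0)
next
  case (Suc n)
  let ?A = "{t. 0 \<le> t \<and> t < real n \<and> t *\<^sub>R d \<in> L}"
  let ?B = "{t. 0 \<le> t \<and> t < 1 \<and> t *\<^sub>R d \<in> L}"
  have eq: "{t. 0 \<le> t \<and> t < real (Suc n) \<and> t *\<^sub>R d \<in> L} = ?A \<union> (\<lambda>t. t + real n) ` ?B"
  proof (intro equalityI subsetI)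
    fix t assume t: "t \<in> {t. 0 \<le> t \<and> t < real (Suc n) \<and> t *\<^sub>R d \<in> L}"
    show "t \<in> ?A \<union> (\<lambda>t. t + real n) ` ?B"
    proof (cases "t < real n")
      case False
      have "(t - real n) *\<^sub>R d \<in> L"
        using t nat_scale_in [OF d(2), of n] by (simp add: scaleR_diff_left diff_in)
      then have "t - real n \<in> ?B"
        using t False by auto
      then have "(t - real n) + real n \<in> (\<lambda>t. t + real n) ` ?B"
        by (rule imageI)
      then show ?thesis by simp
    qed (use t in auto)
  next
    fix t assume "t \<in> ?A \<union> (\<lambda>t. t + real n) ` ?B"
    then show "t \<in> {t. 0 \<le> t \<and> t < real (Suc n) \<and> t *\<^sub>R d \<in> L}"
      using nat_scale_in [OF d(2), of n] by (auto simp: scaleR_add_left add_in)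
  qed
  have "card (?A \<union> (\<lambda>t. t + real n) ` ?B) = card ?A + card ((\<lambda>t. t + real n) ` ?B)"
    by (rule card_Un_disjoint) (use finite_multiples_interval [OF d(1)] in auto)
  also have "card ((\<lambda>t. t + real n) ` ?B) = lattice_length d"
    unfolding lattice_length_def by (rule card_image) (simp add: inj_on_def)
  finally show ?case
    unfolding eq using Suc.IH by simp
qed

lemma card_multiples_closed:
  assumes "d \<noteq> 0" "d \<in> L"
  shows "card {t. 0 \<le> t \<and> t \<le> real n \<and> t *\<^sub>R d \<in> L} = n * lattice_length d + 1"
proof -
  have "{t. 0 \<le> t \<and> t \<le> real n \<and> t *\<^sub>R d \<in> L}
      = insert (real n) {t. 0 \<le> t \<and> t < real n \<and> t *\<^sub>R d \<in> L}"
    using nat_scale_in [OF assms(2), of n] by auto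
  then show ?thesis
    using finite_multiples_interval [OF assms(1)] card_multiples_half_open [OF assms, of n] by simp
qed

lemma card_multiples_open:
  assumes "d \<noteq> 0"
  shows "card {t. 0 < t \<and> t < 1 \<and> t *\<^sub>R d \<in> L} + 1 = lattice_length d"
proof -
  have "{t. 0 \<le> t \<and> t < 1 \<and> t *\<^sub>R d \<in> L} = insert 0 {t. 0 < t \<and> t < 1 \<and> t *\<^sub>R d \<in> L}"
    by auto
  then show ?thesis
    unfolding lattice_length_def using finite_multiples_interval [OF assms] by simp
qed

lemma card_dilate_segment:
  assumes "u \<in> L" "w \<in> L" "u \<noteq> w"
  shows "card (dilate n (closed_segment u w) \<inter> L) = n * lattice_length (w - u) + 1"
proof (cases "n = 0")
  case True
  have "dilate n (closed_segment u w) \<inter> L = {0}"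
    using True by (auto simp: dilate_def)
  then show ?thesis using True by simp
next
  case False
  let ?f = "\<lambda>t. real n *\<^sub>R u + t *\<^sub>R (w - u)"
  have "dilate n (closed_segment u w) \<inter> L = ?f ` {t. 0 \<le> t \<and> t \<le> real n \<and> t *\<^sub>R (w - u) \<in> L}"
  proof (intro equalityI subsetI)
    fix p assume p: "p \<in> dilate n (closed_segment u w) \<inter> L"
    then obtain q where "q \<in> closed_segment u w" "p = real n *\<^sub>R q"
      unfolding dilate_def by blast
    then obtain s where s: "0 \<le> s" "s \<le> 1" "p = real n *\<^sub>R ((1 - s) *\<^sub>R u + s *\<^sub>R w)"
      unfolding in_segment by blast
    have eq: "p = ?f (real n * s)"
      by (simp add: s algebra_simps)
    then have "(real n * s) *\<^sub>R (w - u) \<in> L"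
      using p add_in_iff(2) [OF nat_scale_in [OF assms(1), of n]] by simp
    then show "p \<in> ?f ` {t. 0 \<le> t \<and> t \<le> real n \<and> t *\<^sub>R (w - u) \<in> L}"
      using s eq by (intro image_eqI [of _ _ "real n * s"]) (auto simp: mult_left_le)
  next
    fix p assume "p \<in> ?f ` {t. 0 \<le> t \<and> t \<le> real n \<and> t *\<^sub>R (w - u) \<in> L}"
    then obtain t where t: "p = ?f t" "0 \<le> t" "t \<le> real n" "t *\<^sub>R (w - u) \<in> L" by auto
    have "p = real n *\<^sub>R ((1 - t / real n) *\<^sub>R u + (t / real n) *\<^sub>R w)"
      using False by (simp add: t(1) algebra_simps)
    moreover have "(1 - t / real n) *\<^sub>R u + (t / real n) *\<^sub>R w \<in> closed_segment u w"
      unfolding in_segment using t False by (intro exI [of _ "t / real n"]) auto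
    ultimately have "p \<in> dilate n (closed_segment u w)"
      by (auto simp: dilate_def)
    then show "p \<in> dilate n (closed_segment u w) \<inter> L"
      using t(4) add_in_iff(2) [OF nat_scale_in [OF assms(1), of n]] unfolding t(1) by simp
  qed
  moreover have "inj_on ?f T" for T
    using assms(3) by (auto simp: inj_on_def)
  ultimately show ?thesis
    using assms by (simp add: card_image card_multiples_closed diff_in)
qed

lemma card_open_segment:
  assumes "u \<in> L" "w \<in> L" "u \<noteq> w"
  shows "card (open_segment u w \<inter> L) + 1 = lattice_length (w - u)"
proof -
  let ?f = "\<lambda>t. u + t *\<^sub>R (w - u)"
  have "open_segment u w = ?f ` {0<..<1}"
    using assms(3) by (simp add: open_segment_image_interval algebra_simps)
  moreover have "?f t \<in> L \<longleftrightarrow> t *\<^sub>R (w - u) \<in> L" for t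
    by (rule add_in_iff(2) [OF assms(1)])
  ultimately have "open_segment u w \<inter> L = ?f ` {t. 0 < t \<and> t < 1 \<and> t *\<^sub>R (w - u) \<in> L}"
    by (auto simp only: image_iff greaterThanLessThan_iff mem_Collect_eq Int_iff)
  moreover have "inj_on ?f T" for T
    using assms(3) by (auto simp: inj_on_def)
  ultimately show ?thesis
    using assms by (simp add: card_image flip: card_multiples_open)
qed

end

section \<open>Counting in a parallelogram and in its two halves\<close>

locale planar_lattice_frame = planar_lattice +
  fixes u v :: "real \<times> real"
  assumes u_in: "u \<in> L" and v_in: "v \<in> L" and cross_uv: "cross2 u v \<noteq> 0"
begin

text \<open>The lattice in coordinates relative to \<open>u\<close> and \<open>v\<close>. It
  contains all integer pairs, and others whenever \<open>u\<close> and \<open>v\<close> do not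
  generate \<open>L\<close>.\<close>

definition coords :: "(real \<times> real) set" where
  "coords = {(x, y). x *\<^sub>R u + y *\<^sub>R v \<in> L}"

lemma in_coords: "(x, y) \<in> coords \<longleftrightarrow> x *\<^sub>R u + y *\<^sub>R v \<in> L"
  by (simp add: coords_def)

lemma nonzero: "u \<noteq> 0" "v \<noteq> 0" "u - v \<noteq> 0"
  using cross_uv by auto

lemma shift_coords: "(x + real i, y + real j) \<in> coords \<longleftrightarrow> (x, y) \<in> coords"
proof -
  have "(x + real i) *\<^sub>R u + (y + real j) *\<^sub>R v
      = (x *\<^sub>R u + y *\<^sub>R v) + (real i *\<^sub>R u + real j *\<^sub>R v)"
    by (simp add: algebra_simps)
  moreover have "real i *\<^sub>R u + real j *\<^sub>R v \<in> L"
    by (simp add: add_in nat_scale_in u_in v_in)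
  ultimately show ?thesis
    unfolding in_coords by (metis add_in_iff(1))
qed

text \<open>Lattices are centrally symmetric; this is what makes the two triangles of a
  parallelogram contain equally many points.\<close>

lemma reflect_coords: "(real i - x, real j - y) \<in> coords \<longleftrightarrow> (x, y) \<in> coords"
proof -
  have "(real i - x) *\<^sub>R u + (real j - y) *\<^sub>R v
      = (real i *\<^sub>R u + real j *\<^sub>R v) - (x *\<^sub>R u + y *\<^sub>R v)"
    by (simp add: algebra_simps)
  moreover have "real i *\<^sub>R u + real j *\<^sub>R v \<in> L"
    by (simp add: add_in nat_scale_in u_in v_in)
  ultimately show ?thesis
    unfolding in_coords by (metis diff_in_iff)
qed

lemma finite_coords:
  assumes "B \<subseteq> {-r..r} \<times> {-r..r}"
  shows "finite (B \<inter> coords)"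
proof (rule finite_imageD)
  let ?f = "\<lambda>(x, y). x *\<^sub>R u + y *\<^sub>R v"
  show "inj_on ?f (B \<inter> coords)"
    by (auto simp: inj_on_def cross2_combination_eq_iff [OF cross_uv])
  have "bounded (?f ` B)"
  proof (rule boundedI)
    fix p assume "p \<in> ?f ` B"
    then obtain x y where p: "p = x *\<^sub>R u + y *\<^sub>R v" and "(x, y) \<in> B" by auto
    then have "(x, y) \<in> {-r..r} \<times> {-r..r}"
      using assms by blast
    then have "\<bar>x\<bar> \<le> r" "\<bar>y\<bar> \<le> r"
      by auto
    then have "norm (x *\<^sub>R u) \<le> r * norm u" "norm (y *\<^sub>R v) \<le> r * norm v"
      by (simp_all add: mult_right_mono)
    then show "norm p \<le> r * norm u + r * norm v"
      unfolding p by (intro norm_triangle_mono)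
  qed
  then show "finite (?f ` (B \<inter> coords))"
    by (rule finite_subset [OF _ finite_bounded, rotated]) (auto simp: in_coords)
qed

text \<open>The index in \<open>L\<close> of the subgroup generated by \<open>u\<close> and
  \<open>v\<close>, that is, the area of the parallelogram in units of a fundamental cell.\<close>

definition parallelogram_count :: nat where
  "parallelogram_count = card ({0..<1} \<times> {0..<1} \<inter> coords)"

lemma finite_box:
  assumes "X \<subseteq> {0..real a}" "Y \<subseteq> {0..real b}"
  shows "finite (X \<times> Y \<inter> coords)"
  by (rule finite_coords [of _ "real a + real b"]) (use assms in fastforce)

lemma card_box_shift:
  "card ({real i..<real i + real a} \<times> {real j..<real j + real b} \<inter> coords)
     = card ({0..<real a} \<times> {0..<real b} \<inter> coords)"
proof (rule bij_betw_same_card [symmetric])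
  show "bij_betw (\<lambda>(x, y). (x + real i, y + real j)) ({0..<real a} \<times> {0..<real b} \<inter> coords)
     ({real i..<real i + real a} \<times> {real j..<real j + real b} \<inter> coords)"
  proof (rule bij_betw_byWitness [where f' = "\<lambda>(x, y). (x - real i, y - real j)"])
    have "(x - real i, y - real j) \<in> coords \<longleftrightarrow> (x, y) \<in> coords" for x y
      using shift_coords [of "x - real i" i "y - real j" j] by simp
    then show "(\<lambda>(x, y). (x - real i, y - real j)) ` ({real i..<real i + real a} \<times> {real j..<real j + real b} \<inter> coords)
      \<subseteq> {0..<real a} \<times> {0..<real b} \<inter> coords"
      by auto
  qed (auto simp: shift_coords)
qed

lemma card_half_open_box:
  "card ({0..<real a} \<times> {0..<real b} \<inter> coords) = a * b * parallelogram_count"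
proof -
  have one: "card ({0..<1} \<times> {0..<real b} \<inter> coords) = b * parallelogram_count" for b
  proof (induction b)
    case (Suc b)
    have "{0..<1} \<times> {0..<real (Suc b)} \<inter> coords
       = ({0..<1} \<times> {0..<real b} \<inter> coords) \<union> ({0..<1} \<times> {real b..<real b + 1} \<inter> coords)"
      by auto
    also have "card \<dots> = card ({0..<1} \<times> {0..<real b} \<inter> coords) + card ({0..<1} \<times> {real b..<real b + 1} \<inter> coords)"
      by (rule card_Un_disjoint) (auto intro!: finite_box [of _ 1 _ "b + 1"])
    also have "card ({0..<1} \<times> {real b..<real b + 1} \<inter> coords) = parallelogram_count"
      using card_box_shift [of 0 1 b 1] by (simp add: parallelogram_count_def)
    finally show ?case
      using Suc.IH by simp
  qed simp
  show ?thesis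
  proof (induction a)
    case (Suc a)
    have "{0..<real (Suc a)} \<times> {0..<real b} \<inter> coords
       = ({0..<real a} \<times> {0..<real b} \<inter> coords) \<union> ({real a..<real a + 1} \<times> {0..<real b} \<inter> coords)"
      by auto
    also have "card \<dots> = card ({0..<real a} \<times> {0..<real b} \<inter> coords) + card ({real a..<real a + 1} \<times> {0..<real b} \<inter> coords)"
      by (rule card_Un_disjoint) (auto intro!: finite_box [of _ "a + 1" _ b])
    also have "card ({real a..<real a + 1} \<times> {0..<real b} \<inter> coords) = b * parallelogram_count"
      using card_box_shift [of a 1 0 b] one by simp
    finally show ?case
      using Suc.IH by (simp add: algebra_simps)
  qed simp
qed

lemma edge_coords_u: "({t. P t} \<times> {real j}) \<inter> coords = (\<lambda>t. (t, real j)) ` {t. P t \<and> t *\<^sub>R u \<in> L}"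
  using shift_coords [of _ 0 0 j] by (auto simp: in_coords)

lemma edge_coords_v: "({real i} \<times> {t. P t}) \<inter> coords = (\<lambda>t. (real i, t)) ` {t. P t \<and> t *\<^sub>R v \<in> L}"
  using shift_coords [of 0 i _ 0] by (auto simp: in_coords)

lemma diagonal_coords: "{(x, y). P x \<and> x + y = real n} \<inter> coords
   = (\<lambda>t. (t, real n - t)) ` {t. P t \<and> t *\<^sub>R (u - v) \<in> L}"
proof -
  have "t *\<^sub>R u + (real n - t) *\<^sub>R v = t *\<^sub>R (u - v) + real n *\<^sub>R v" for t
    by (simp add: algebra_simps)
  then have iff: "(t, real n - t) \<in> coords \<longleftrightarrow> t *\<^sub>R (u - v) \<in> L" for t
    unfolding in_coords using add_in_iff(1) nat_scale_in [OF v_in] by metis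
  show ?thesis
  proof (intro equalityI subsetI)
    fix p assume p: "p \<in> {(x, y). P x \<and> x + y = real n} \<inter> coords"
    obtain x y where xy: "p = (x, y)" by (cases p)
    then have "y = real n - x"
      using p by auto
    then have "p = (x, real n - x)" "P x" "(x, real n - x) \<in> coords"
      using p xy by auto
    then show "p \<in> (\<lambda>t. (t, real n - t)) ` {t. P t \<and> t *\<^sub>R (u - v) \<in> L}"
      by (auto simp only: iff)
  qed (use iff in auto)
qed

text \<open>The half-open box lacks the top and right edges. The common corner is counted with the
  right edge only, which accounts for the final 1.\<close>

lemma card_closed_box:
  "card ({0..real n} \<times> {0..real n} \<inter> coords)
     = n * n * parallelogram_count + n * lattice_length u + n * lattice_length v + 1"
proof -
  let ?A = "{0..<real n} \<times> {0..<real n} \<inter> coords"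
  let ?B = "({t. 0 \<le> t \<and> t < real n} \<times> {real n}) \<inter> coords"
  let ?C = "({real n} \<times> {t. 0 \<le> t \<and> t \<le> real n}) \<inter> coords"
  have eq: "{0..real n} \<times> {0..real n} \<inter> coords = ?A \<union> (?B \<union> ?C)" by auto
  have fin: "finite ?A" "finite ?B" "finite ?C"
    by (auto intro!: finite_box [of _ n _ n])
  have "card ?B = n * lattice_length u"
    unfolding edge_coords_u using card_multiples_half_open [OF nonzero(1) u_in]
    by (subst card_image) (auto simp: inj_on_def conj_assoc)
  moreover have "card ?C = n * lattice_length v + 1"
    unfolding edge_coords_v using card_multiples_closed [OF nonzero(2) v_in]
    by (subst card_image) (auto simp: inj_on_def conj_assoc)
  moreover have "card (?A \<union> (?B \<union> ?C)) = card ?A + (card ?B + card ?C)"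
    using fin by (subst card_Un_disjoint, auto, subst card_Un_disjoint, auto)
  ultimately show ?thesis
    unfolding eq by (simp add: card_half_open_box)
qed

definition triangle_coords :: "nat \<Rightarrow> (real \<times> real) set" where
  "triangle_coords n = {(x, y). 0 \<le> x \<and> 0 \<le> y \<and> x + y \<le> real n} \<inter> coords"

lemma finite_triangle_coords: "finite (triangle_coords n)"
  unfolding triangle_coords_def by (rule finite_coords [of _ "real n"]) auto

text \<open>Reflection in the centre of the box carries the triangle to the complementary one; they
  cover the box and overlap in the diagonal. So twice the count is the count of the box plus that of
  the diagonal.\<close>

lemma card_triangle_coords:
  "2 * card (triangle_coords n) = n * n * parallelogram_count
     + n * (lattice_length u + lattice_length v + lattice_length (u - v)) + 2"
proof -
  let ?R = "{(x, y). x \<le> real n \<and> y \<le> real n \<and> real n \<le> x + y} \<inter> coords"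
  have fin: "finite ?R"
    by (rule finite_coords [of _ "real n"]) auto
  have "bij_betw (\<lambda>(x, y). (real n - x, real n - y)) (triangle_coords n) ?R"
    by (rule bij_betw_byWitness [where f' = "\<lambda>(x, y). (real n - x, real n - y)"])
       (auto simp: triangle_coords_def reflect_coords)
  then have R: "card ?R = card (triangle_coords n)"
    by (simp add: bij_betw_same_card)
  have "triangle_coords n \<inter> ?R = {(x, y). (0 \<le> x \<and> x \<le> real n) \<and> x + y = real n} \<inter> coords"
    by (auto simp: triangle_coords_def)
  also have "card \<dots> = n * lattice_length (u - v) + 1"
    unfolding diagonal_coords using card_multiples_closed [OF nonzero(3) diff_in [OF u_in v_in]]
    by (subst card_image) (auto simp: inj_on_def conj_assoc)
  finally have int: "card (triangle_coords n \<inter> ?R) = n * lattice_length (u - v) + 1" .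
  have "triangle_coords n \<union> ?R = {0..real n} \<times> {0..real n} \<inter> coords"
    by (auto simp: triangle_coords_def)
  then have "card (triangle_coords n) + card ?R
      = card ({0..real n} \<times> {0..real n} \<inter> coords) + card (triangle_coords n \<inter> ?R)"
    using card_Un_Int [OF finite_triangle_coords fin, of n] by simp
  then show ?thesis
    unfolding R int card_closed_box by (simp add: algebra_simps)
qed

definition open_triangle_coords :: "(real \<times> real) set" where
  "open_triangle_coords = {(x, y). 0 < x \<and> 0 < y \<and> x + y < 1} \<inter> coords"

text \<open>The half-open unit box splits into one half-open edge, one open edge, the open diagonal
  and two open triangles exchanged by reflection. The two open segments each lose a point against
  their lattice length, hence the 2.\<close>

lemma card_open_triangle_coords:
  "2 * card open_triangle_coords + lattice_length u + lattice_length v + lattice_length (u - v)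
     = parallelogram_count + 2"
proof -
  let ?A = "({t. 0 \<le> t \<and> t < 1} \<times> {real 0}) \<inter> coords"
  let ?B = "({real 0} \<times> {t. 0 < t \<and> t < 1}) \<inter> coords"
  let ?C = "{(x, y). (0 < x \<and> x < 1) \<and> x + y = real 1} \<inter> coords"
  let ?R = "{(x, y). x < 1 \<and> y < 1 \<and> 1 < x + y} \<inter> coords"
  have fin: "finite ?A" "finite ?B" "finite ?C" "finite ?R" "finite open_triangle_coords"
    unfolding open_triangle_coords_def by (auto intro!: finite_coords [of _ 1])
  have eq: "{0..<1} \<times> {0..<1} \<inter> coords = ?A \<union> (?B \<union> (?C \<union> (open_triangle_coords \<union> ?R)))"
    by (auto simp: open_triangle_coords_def)
  have "bij_betw (\<lambda>(x, y). (1 - x, 1 - y)) open_triangle_coords ?R"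
    using reflect_coords [of 1 _ 1]
    by (intro bij_betw_byWitness [where f' = "\<lambda>(x, y). (1 - x, 1 - y)"])
       (auto simp: open_triangle_coords_def)
  then have R: "card ?R = card open_triangle_coords"
    by (simp add: bij_betw_same_card)
  have A: "card ?A = lattice_length u"
    unfolding edge_coords_u lattice_length_def
    by (subst card_image) (auto simp: inj_on_def conj_assoc)
  have B: "card ?B + 1 = lattice_length v"
    unfolding edge_coords_v card_multiples_open [OF nonzero(2), symmetric]
    by (subst card_image) (auto simp: inj_on_def conj_assoc)
  have C: "card ?C + 1 = lattice_length (u - v)"
    unfolding diagonal_coords card_multiples_open [OF nonzero(3), symmetric]
    by (subst card_image) (auto simp: inj_on_def conj_assoc)
  have "card (open_triangle_coords \<union> ?R) = card open_triangle_coords + card ?R"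
    using fin by (intro card_Un_disjoint) (auto simp: open_triangle_coords_def)
  moreover have "card (?C \<union> (open_triangle_coords \<union> ?R)) = card ?C + card (open_triangle_coords \<union> ?R)"
    using fin by (intro card_Un_disjoint) (auto simp: open_triangle_coords_def)
  moreover have "card (?B \<union> (?C \<union> (open_triangle_coords \<union> ?R)))
      = card ?B + card (?C \<union> (open_triangle_coords \<union> ?R))"
    using fin by (intro card_Un_disjoint) (auto simp: open_triangle_coords_def)
  moreover have "card (?A \<union> (?B \<union> (?C \<union> (open_triangle_coords \<union> ?R))))
      = card ?A + card (?B \<union> (?C \<union> (open_triangle_coords \<union> ?R)))"
    using fin by (intro card_Un_disjoint) (auto simp: open_triangle_coords_def)
  ultimately have "parallelogram_count = card ?A + (card ?B + (card ?C + 2 * card open_triangle_coords))"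
    unfolding parallelogram_count_def eq using R by simp
  then show ?thesis using A B C by simp
qed

end

subsection \<open>Cutting planar convex hulls\<close>

lemma cross2_eq_0_iff:
  assumes "d \<noteq> 0"
  shows "cross2 d p = 0 \<longleftrightarrow> (\<exists>t. p = t *\<^sub>R d)"
proof
  assume c: "cross2 d p = 0"
  show "\<exists>t. p = t *\<^sub>R d"
  proof (cases "fst d = 0")
    case True
    then have "snd d \<noteq> 0"
      using assms by (simp add: prod_eq_iff)
    then show ?thesis
      using c True by (intro exI [of _ "snd p / snd d"]) (auto simp: cross2_def prod_eq_iff)
  next
    case False
    then show ?thesis
      using c by (intro exI [of _ "fst p / fst d"]) (auto simp: cross2_def prod_eq_iff field_simps)
  qed
qed auto

lemma collinear_cross2: "collinear S \<longleftrightarrow> (\<forall>a\<in>S. \<forall>b\<in>S. \<forall>c\<in>S. cross2 (b - a) (c - a) = 0)"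
proof
  assume "collinear S"
  then obtain d where d: "\<And>x y. x \<in> S \<Longrightarrow> y \<in> S \<Longrightarrow> \<exists>t. x - y = t *\<^sub>R d"
    unfolding collinear_def by blast
  show "\<forall>a\<in>S. \<forall>b\<in>S. \<forall>c\<in>S. cross2 (b - a) (c - a) = 0"
  proof (intro ballI)
    fix a b c assume "a \<in> S" "b \<in> S" "c \<in> S"
    then obtain s t where "b - a = s *\<^sub>R d" "c - a = t *\<^sub>R d"
      using d by meson
    then show "cross2 (b - a) (c - a) = 0"
      by (simp only:) simp
  qed
next
  assume c: "\<forall>a\<in>S. \<forall>b\<in>S. \<forall>c\<in>S. cross2 (b - a) (c - a) = 0"
  show "collinear S"
  proof (cases "\<exists>a b. a \<in> S \<and> b \<in> S \<and> a \<noteq> b")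
    case True
    then obtain a b where ab: "a \<in> S" "b \<in> S" "b - a \<noteq> 0" by auto
    have "\<exists>t. x - y = t *\<^sub>R (b - a)" if "x \<in> S" "y \<in> S" for x y
    proof -
      have "cross2 (b - a) (x - y) = cross2 (b - a) (x - a) - cross2 (b - a) (y - a)"
        by simp
      also have "\<dots> = 0"
        using c ab that by (metis diff_self)
      finally show ?thesis
        using cross2_eq_0_iff [OF ab(3)] by blast
    qed
    then show ?thesis
      unfolding collinear_def by blast
  next
    case False
    then have "x - y = 0 *\<^sub>R 0" if "x \<in> S" "y \<in> S" for x y
      using that by (metis diff_self scaleR_zero_right)
    then show ?thesis
      unfolding collinear_def by blast
  qed
qed

lemma not_collinearI:
  "\<lbrakk>a \<in> S; b \<in> S; c \<in> S; cross2 (b - a) (c - a) \<noteq> 0\<rbrakk> \<Longrightarrow> \<not> collinear S"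
  unfolding collinear_cross2 by blast

lemma collinear_convex_hull_iff: "collinear (convex hull S) \<longleftrightarrow> collinear S"
  for S :: "'a::euclidean_space set"
  by (simp add: collinear_aff_dim aff_dim_convex_hull)

lemma halfplane_inner: "{p. c \<le> cross2 d p} = {p. c \<le> (- snd d, fst d) \<bullet> p}"
  "{p. c < cross2 d p} = {p. c < (- snd d, fst d) \<bullet> p}"
  by (auto simp: cross2_def inner_prod_def)

lemma convex_halfplane: "convex {p. 0 \<le> cross2 d (p - a)}"
proof -
  have "{p. 0 \<le> cross2 d (p - a)} = {p. cross2 d a \<le> cross2 d p}"
    by auto
  then show ?thesis
    unfolding halfplane_inner by (simp add: convex_halfspace_ge)
qed

lemma interior_halfplane:
  assumes "d \<noteq> 0"
  shows "interior {p. 0 \<le> cross2 d (p - a)} = {p. 0 < cross2 d (p - a)}"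
proof -
  have "{p. 0 \<le> cross2 d (p - a)} = {p. cross2 d a \<le> cross2 d p}"
    "{p. 0 < cross2 d (p - a)} = {p. cross2 d a < cross2 d p}"
    by auto
  moreover have "(- snd d, fst d) \<noteq> 0"
    using assms by (auto simp: prod_eq_iff)
  ultimately show ?thesis
    unfolding halfplane_inner by (metis interior_halfspace_ge)
qed

text \<open>Cramer's rule expresses the coordinates continuously, so their strict inequalities cut
  out an open subset \<open>T\<close> of the triangle.\<close>

lemma interior_triangle:
  assumes uv: "cross2 u v \<noteq> 0" and xy: "0 < x" "0 < y" "x + y < 1"
  shows "a + x *\<^sub>R u + y *\<^sub>R v \<in> interior (convex hull {a, a + u, a + v})"
proof -
  let ?c = "cross2 u v"
  let ?X = "\<lambda>p. cross2 (p - a) v / ?c" and ?Y = "\<lambda>p. cross2 u (p - a) / ?c"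
  define T where "T = {p. 0 < ?X p} \<inter> {p. 0 < ?Y p} \<inter> {p. ?X p + ?Y p < 1}"
  have "open T"
    unfolding T_def cross2_def by (intro open_Int open_Collect_less continuous_intros) (use uv in \<open>auto simp: cross2_def\<close>)
  moreover have "T \<subseteq> convex hull {a, a + u, a + v}"
  proof
    fix p assume p: "p \<in> T"
    have "p - a = (1 / ?c) *\<^sub>R (?c *\<^sub>R (p - a))"
      using uv by simp
    also have "\<dots> = ?X p *\<^sub>R u + ?Y p *\<^sub>R v"
      unfolding cross2_decompose [of u v "p - a"] by (simp add: scaleR_add_right)
    finally have "p = a + ?X p *\<^sub>R u + ?Y p *\<^sub>R v"
      by (metis add.assoc add_diff_cancel_left' diff_add_cancel add.commute)
    moreover have "0 \<le> ?X p" "0 \<le> ?Y p" "?X p + ?Y p \<le> 1"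
      using p by (auto simp: T_def)
    ultimately show "p \<in> convex hull {a, a + u, a + v}"
      unfolding convex_hull_3_alt add_diff_cancel_left' mem_Collect_eq by blast
  qed
  moreover have "a + x *\<^sub>R u + y *\<^sub>R v \<in> T"
  proof -
    have "?X (a + x *\<^sub>R u + y *\<^sub>R v) = x" "?Y (a + x *\<^sub>R u + y *\<^sub>R v) = y"
      using uv by (simp_all add: add.assoc)
    then show ?thesis
      using xy unfolding T_def by (simp only: Int_iff mem_Collect_eq simp_thms)
  qed
  ultimately show ?thesis
    by (meson interiorI)
qed

text \<open>A supporting line at a point strictly between \<open>u\<close> and \<open>w\<close> has
  to contain both, so it is the line \<open>uw\<close>; but \<open>s\<close> and \<open>t\<close>
  lie strictly on opposite sides of it.\<close>

lemma open_segment_subset_interior: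
  fixes P :: "(real \<times> real) set"
  assumes P: "convex P" and uw: "u \<in> P" "w \<in> P"
    and s: "s \<in> P" "0 < cross2 (w - u) (s - u)" and t: "t \<in> P" "cross2 (w - u) (t - u) < 0"
  shows "open_segment u w \<subseteq> interior P"
proof
  fix p assume p: "p \<in> open_segment u w"
  have "\<not> collinear P"
    using not_collinearI [OF uw s(1)] s(2) by simp
  then have "aff_dim P = 2"
    using aff_dim_le_DIM [of P] by (simp add: collinear_aff_dim)
  then have int: "interior P = rel_interior P"
    by (simp add: interior_rel_interior_gen)
  have pP: "p \<in> P"
    using p uw P by (meson convex_contains_open_segment subsetD)
  show "p \<in> interior P"
  proof (rule ccontr)
    assume "p \<notin> interior P"
    then have "p \<notin> rel_interior P" using int by simp
    then obtain n where n: "n \<noteq> 0" "\<And>y. y \<in> P \<Longrightarrow> n \<bullet> p \<le> n \<bullet> y"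
      using supporting_hyperplane_relative_frontier [OF P, of p] pP closure_subset
      by (metis subsetD)
    obtain r where r: "0 < r" "r < 1" "p = (1 - r) *\<^sub>R u + r *\<^sub>R w"
      using p by (auto simp: in_segment)
    have np: "n \<bullet> p = (1 - r) * (n \<bullet> u) + r * (n \<bullet> w)"
      by (simp add: r(3) inner_add_right)
    have le: "0 \<le> (1 - r) * (n \<bullet> u - n \<bullet> p)" "0 \<le> r * (n \<bullet> w - n \<bullet> p)"
      using r n(2) uw by simp_all
    moreover have "(1 - r) * (n \<bullet> u - n \<bullet> p) + r * (n \<bullet> w - n \<bullet> p) = 0"
      using np by (simp add: algebra_simps)
    ultimately have "(1 - r) * (n \<bullet> u - n \<bullet> p) = 0" "r * (n \<bullet> w - n \<bullet> p) = 0"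
      by linarith+
    then have eq: "n \<bullet> u = n \<bullet> p" "n \<bullet> w = n \<bullet> p"
      using r by auto
    let ?d = "w - u"
    have perp: "n \<bullet> ?d = 0"
      using eq by (simp add: inner_diff_right)
    have d: "?d \<noteq> 0" using s by auto
    \<comment> \<open>In the plane, a normal vector orthogonal to \<open>w - u\<close> becomes a
      multiple of \<open>w - u\<close> after a quarter turn, so the functional is a multiple of the
      side test.\<close>
    have "cross2 ?d (- snd n, fst n) = 0"
      using perp by (simp add: cross2_def inner_prod_def algebra_simps)
    then obtain k where k: "(- snd n, fst n) = k *\<^sub>R ?d"
      using cross2_eq_0_iff [OF d] by blast
    have nk: "n \<bullet> y = k * cross2 y ?d" for y
      using arg_cong [OF k, of "cross2 y"] by (simp add: cross2_def inner_prod_def algebra_simps)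
    have "k \<noteq> 0" using k n(1) by (auto simp: prod_eq_iff)
    have "0 \<le> n \<bullet> (s - u)" "0 \<le> n \<bullet> (t - u)"
      using n(2) [OF s(1)] n(2) [OF t(1)] eq by (simp_all add: inner_diff_right)
    then have "0 \<le> k * cross2 (s - u) ?d" "0 \<le> k * cross2 (t - u) ?d"
      unfolding nk by simp_all
    moreover have "cross2 (s - u) ?d < 0" "0 < cross2 (t - u) ?d"
      using s(2) t(2) by (subst cross2_commute, linarith)+
    ultimately show False
      using \<open>k \<noteq> 0\<close> by (auto simp: zero_le_mult_iff)
  qed
qed

section \<open>Cutting a polygon along a chord joining two vertices\<close>

definition convex_independent :: "'a::real_vector set \<Rightarrow> bool" where
  "convex_independent S \<longleftrightarrow> (\<forall>a\<in>S. a \<notin> convex hull (S - {a}))"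

context
  fixes S :: "(real \<times> real) set" and u w
  assumes S: "finite S" "convex_independent S" and u: "u \<in> S" and w: "w \<in> S" and uw: "u \<noteq> w"
begin

text \<open>If the line met the hull beyond \<open>u\<close> or \<open>w\<close>, that vertex would
  lie strictly inside a segment of the hull, although it is an extreme point.\<close>

lemma chord_eq_segment:
  "convex hull S \<inter> {p. cross2 (w - u) (p - u) = 0} = closed_segment u w"
proof (intro equalityI subsetI)
  fix p assume "p \<in> convex hull S \<inter> {p. cross2 (w - u) (p - u) = 0}"
  then have p: "p \<in> convex hull S" and "cross2 (w - u) (p - u) = 0" by auto
  then obtain t where t: "p - u = t *\<^sub>R (w - u)"
    using cross2_eq_0_iff uw by (metis right_minus_eq)
  have extreme: "x extreme_point_of (convex hull S)" if "x \<in> S" for x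
    using that extreme_point_of_convex_hull_convex_independent [of S x] S
    by (auto simp: convex_independent_def finite_imp_compact)
  have hull: "u \<in> convex hull S" "w \<in> convex hull S"
    using u w by (auto intro: hull_inc)
  have p_eq: "p = u + t *\<^sub>R (w - u)"
    using t by (metis add.commute diff_add_cancel)
  have "t \<le> 1"
  proof (rule ccontr)
    assume "\<not> t \<le> 1"
    then have "w = (1 - 1 / t) *\<^sub>R u + (1 / t) *\<^sub>R p"
      by (simp add: p_eq algebra_simps)
    moreover have "u \<noteq> p"
      using p_eq uw \<open>\<not> t \<le> 1\<close> by auto
    ultimately have "w \<in> open_segment u p"
      unfolding in_segment using \<open>\<not> t \<le> 1\<close> by (intro conjI exI [of _ "1 / t"]) auto
    then show False
      using extreme [OF w] hull p by (auto simp: extreme_point_of_def)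
  qed
  moreover have "0 \<le> t"
  proof (rule ccontr)
    assume "\<not> 0 \<le> t"
    \<comment> \<open>\<open>r\<close> is the parameter of \<open>u\<close> on the segment from
      \<open>w\<close> to \<open>p\<close>, since
      \<open>p - w = (t - 1) *\<^sub>R (w - u)\<close>.\<close>
    define r where "r = 1 / (1 - t)"
    have r: "0 < r" "r < 1" "r * (1 - t) = 1"
      using \<open>\<not> 0 \<le> t\<close> by (auto simp: r_def)
    have "(1 - r) *\<^sub>R w + r *\<^sub>R p = w - (r * (1 - t)) *\<^sub>R (w - u)"
      by (simp add: p_eq algebra_simps)
    then have "u = (1 - r) *\<^sub>R w + r *\<^sub>R p"
      by (simp add: r(3))
    moreover have "w \<noteq> p"
    proof
      assume "w = p"
      then have "(t - 1) *\<^sub>R (w - u) = 0"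
        using t by (simp add: scaleR_diff_left)
      then show False
        using uw \<open>\<not> 0 \<le> t\<close> by simp
    qed
    ultimately have "u \<in> open_segment w p"
      unfolding in_segment using r by blast
    then show False
      using extreme [OF u] hull p by (auto simp: extreme_point_of_def)
  qed
  ultimately show "p \<in> closed_segment u w"
    unfolding in_segment by (intro exI [of _ t]) (simp add: p_eq algebra_simps)
next
  fix p assume p: "p \<in> closed_segment u w"
  then obtain r where "p = (1 - r) *\<^sub>R u + r *\<^sub>R w"
    by (auto simp: in_segment)
  then have "p - u = r *\<^sub>R (w - u)"
    by (simp add: algebra_simps)
  then have "cross2 (w - u) (p - u) = 0"
    by (simp only: cross2_simps)
  moreover have "p \<in> convex hull S"
    using p u w by (meson closed_segment_subset convex_convex_hull hull_inc subsetD)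
  ultimately show "p \<in> convex hull S \<inter> {p. cross2 (w - u) (p - u) = 0}"
    by simp
qed

text \<open>The cut creates no new vertices. A point of the half-plane lies on a segment from
  \<open>a\<close> in \<open>convex hull A\<close> to \<open>b\<close> in
  \<open>convex hull B\<close>; this segment meets the line in a point of the chord, which already
  belongs to \<open>convex hull A\<close>.\<close>

lemma halfplane_cut_eq_hull:
  "convex hull S \<inter> {p. 0 \<le> cross2 (w - u) (p - u)} = convex hull (S \<inter> {p. 0 \<le> cross2 (w - u) (p - u)})"
proof -
  let ?f = "\<lambda>p. cross2 (w - u) (p - u)"
  define A B where "A = S \<inter> {p. 0 \<le> ?f p}" and "B = S \<inter> {p. ?f p \<le> 0}"
  have "?f w = 0"
    by (rule cross2_simps(7))
  moreover have "?f u = 0"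
    by simp
  ultimately have uwA: "u \<in> A" "w \<in> A" and uB: "u \<in> B"
    using u w unfolding A_def B_def Int_iff mem_Collect_eq by (metis order_refl)+
  have A_pos: "convex hull A \<subseteq> {p. 0 \<le> ?f p}"
    by (rule hull_minimal) (use convex_halfplane in \<open>auto simp only: A_def\<close>)
  have "convex hull B \<subseteq> {p. 0 \<le> cross2 (u - w) (p - w)}"
  proof (rule hull_minimal)
    have "cross2 (u - w) (p - w) = - ?f p" for p
      by (simp add: cross2_def algebra_simps)
    then show "B \<subseteq> {p. 0 \<le> cross2 (u - w) (p - w)}"
      by (auto simp only: B_def)
  qed (rule convex_halfplane)
  moreover have swap: "cross2 (u - w) (p - w) = - ?f p" for p
    by (simp add: cross2_def algebra_simps)
  ultimately have B_neg: "convex hull B \<subseteq> {p. ?f p \<le> 0}"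
    by auto
  have f_affine: "?f ((1 - r) *\<^sub>R a + r *\<^sub>R b) = (1 - r) * ?f a + r * ?f b" for a b r
    by (simp add: algebra_simps)
  have seg_A: "closed_segment u w \<subseteq> convex hull A"
    using uwA by (meson closed_segment_subset convex_convex_hull hull_inc)
  have "convex hull S \<inter> {p. 0 \<le> ?f p} \<subseteq> convex hull A"
  proof
    fix p assume p: "p \<in> convex hull S \<inter> {p. 0 \<le> ?f p}"
    have "S \<subseteq> convex hull A \<union> convex hull B"
      using hull_subset [of A convex] hull_subset [of B convex] by (force simp only: A_def B_def)
    then have "p \<in> convex hull (convex hull A \<union> convex hull B)"
      using p hull_mono by blast
    moreover have "convex hull A \<noteq> {}" "convex hull B \<noteq> {}"
      using uwA uB by auto
    ultimately obtain a b r' r where ab: "a \<in> convex hull A" "b \<in> convex hull B"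
      and r': "0 \<le> r'" "0 \<le> r" "r' + r = 1" "p = r' *\<^sub>R a + r *\<^sub>R b"
      using convex_hull_union_two [of "convex hull A" "convex hull B"] convex_convex_hull by blast
    then have "r' = 1 - r" by simp
    then have r: "0 \<le> r" "r \<le> 1" and p_eq: "p = (1 - r) *\<^sub>R a + r *\<^sub>R b"
      using r' by auto
    have a: "0 \<le> ?f a" and b: "?f b \<le> 0"
      using ab A_pos B_neg by auto
    have hull: "a \<in> convex hull S" "b \<in> convex hull S"
      using ab hull_mono [of A S] hull_mono [of B S] by (auto simp: A_def B_def)
    have "0 \<le> ?f p"
      using p by blast
    then have fp: "0 \<le> (1 - r) * ?f a + r * ?f b"
      unfolding p_eq f_affine .
    show "p \<in> convex hull A"
    proof (cases "?f b = 0")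
      case True
      then have "b \<in> convex hull A"
        using chord_eq_segment hull seg_A by blast
      then show ?thesis
        unfolding p_eq using ab r by (intro convexD [OF convex_convex_hull]) auto
    next
      case False
      \<comment> \<open>\<open>s\<close> is where the affine side test vanishes between
        \<open>a\<close> and \<open>b\<close>, so \<open>q\<close> is the crossing point. As
        \<open>p\<close> has parameter \<open>r \<le> s\<close>, it lies between \<open>a\<close>
        and \<open>q\<close>, at parameter \<open>r / s\<close> unless \<open>s = 0\<close>.\<close>
      define s where "s = ?f a / (?f a - ?f b)"
      have pos: "?f a - ?f b > 0" using a b False by linarith
      have s: "0 \<le> s" "s \<le> 1"
        using a b False pos by (auto simp: s_def)
      define q where "q = (1 - s) *\<^sub>R a + s *\<^sub>R b"
      have "?f q = ?f a - s * (?f a - ?f b)"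
        unfolding q_def f_affine by (simp only: algebra_simps)
      also have "\<dots> = 0"
        using pos by (simp add: s_def)
      finally have "?f q = 0" .
      moreover have "q \<in> convex hull S"
        unfolding q_def using hull s by (intro convexD [OF convex_convex_hull]) auto
      ultimately have q: "q \<in> convex hull A"
        using chord_eq_segment seg_A by blast
      have "r * (?f a - ?f b) \<le> ?f a"
        using fp by (simp only: algebra_simps)
      then have rs: "r \<le> s"
        using pos by (simp add: s_def field_simps)
      show ?thesis
      proof (cases "s = 0")
        case True
        then have "r = 0" using rs r by simp
        then show ?thesis using ab p_eq by simp
      next
        case False
        then have "p = (1 - r / s) *\<^sub>R a + (r / s) *\<^sub>R q"
          unfolding q_def p_eq by (simp add: algebra_simps)
        then show ?thesis
          using ab q s rs r False by (simp only:) (intro convexD [OF convex_convex_hull]; simp)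
      qed
    qed
  qed
  moreover have "convex hull A \<subseteq> convex hull S"
    by (rule hull_mono) (simp add: A_def)
  ultimately show ?thesis
    using A_pos unfolding A_def by blast
qed

end

text \<open>With \<open>o(xyz)\<close> twice the signed area, \<open>o(abd) + o(bcd) + o(cad) = o(abc)\<close>, and these three
  numbers are the barycentric coordinates of \<open>d\<close>; so one of them is negative.\<close>

lemma ex_separating_chord:
  assumes S: "finite S" "convex_independent S" "\<not> collinear S" "card S \<ge> 4"
  obtains u w s t where "u \<in> S" "w \<in> S" "s \<in> S" "t \<in> S"
    "0 < cross2 (w - u) (s - u)" "cross2 (w - u) (t - u) < 0"
proof -
  obtain a b c where abc: "a \<in> S" "b \<in> S" "c \<in> S" "0 < cross2 (b - a) (c - a)"
  proof -
    obtain a b c where abc: "a \<in> S" "b \<in> S" "c \<in> S" "cross2 (b - a) (c - a) \<noteq> 0"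
      using S(3) unfolding collinear_cross2 by blast
    show thesis
    proof (cases "0 < cross2 (b - a) (c - a)")
      case True
      then show ?thesis using abc that by blast
    next
      case False
      then have "0 < cross2 (c - a) (b - a)"
        using abc(4) by (subst cross2_commute) linarith
      then show ?thesis using abc that by blast
    qed
  qed
  have "card {a, b, c} \<le> 3"
    by (simp add: card_insert_if)
  then have "\<not> S \<subseteq> {a, b, c}"
    using S(4) card_mono [of "{a, b, c}" S] by auto
  then obtain d where d: "d \<in> S" "d \<notin> {a, b, c}" by blast
  let ?o = "cross2 (b - a) (c - a)"
  let ?x = "cross2 (b - a) (d - a)" and ?y = "cross2 (c - b) (d - b)" and ?z = "cross2 (a - c) (d - c)"
  have sum: "?x + ?y + ?z = ?o"
    by (simp add: cross2_def algebra_simps)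
  have comb: "?o *\<^sub>R d = ?y *\<^sub>R a + ?z *\<^sub>R b + ?x *\<^sub>R c"
    by (simp add: cross2_def prod_eq_iff algebra_simps)
  have "\<not> (0 \<le> ?x \<and> 0 \<le> ?y \<and> 0 \<le> ?z)"
  proof
    assume nonneg: "0 \<le> ?x \<and> 0 \<le> ?y \<and> 0 \<le> ?z"
    have "d = (1 / ?o) *\<^sub>R (?o *\<^sub>R d)"
      using abc(4) by simp
    also have "\<dots> = (?y / ?o) *\<^sub>R a + (?z / ?o) *\<^sub>R b + (?x / ?o) *\<^sub>R c"
      unfolding comb by (simp add: scaleR_add_right)
    finally have "d = (?y / ?o) *\<^sub>R a + (?z / ?o) *\<^sub>R b + (?x / ?o) *\<^sub>R c" .
    moreover have "?y / ?o + ?z / ?o + ?x / ?o = 1"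
    proof -
      have "?y / ?o + ?z / ?o + ?x / ?o = (?x + ?y + ?z) / ?o"
        by (simp only: add_divide_distrib add_ac)
      then show ?thesis
        using abc(4) unfolding sum by simp
    qed
    moreover have "0 \<le> ?y / ?o" "0 \<le> ?z / ?o" "0 \<le> ?x / ?o"
      using nonneg abc(4) by (simp_all only: divide_nonneg_pos)
    ultimately have "d \<in> convex hull {a, b, c}"
      unfolding convex_hull_3 by blast
    also have "\<dots> \<subseteq> convex hull (S - {d})"
      by (rule hull_mono) (use abc d in auto)
    finally show False
      using S(2) d by (simp add: convex_independent_def)
  qed
  moreover have "0 < cross2 (c - b) (a - b)" "0 < cross2 (a - c) (b - c)"
    using abc(4) by (simp_all add: cross2_def algebra_simps)
  \<comment> \<open>The triangle is positively oriented, so for each edge the opposite vertex is on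
    the positive side; the edge with negative number has \<open>d\<close> on the other side.\<close>
  ultimately consider "?x < 0" | "?y < 0" "0 < cross2 (c - b) (a - b)" | "?z < 0" "0 < cross2 (a - c) (b - c)"
    by linarith
  then show thesis
  proof cases
    case 1
    show thesis by (rule that [OF abc(1,2,3) d(1) abc(4) 1])
  next
    case 2
    show thesis by (rule that [OF abc(2,3,1) d(1) 2(2,1)])
  next
    case 3
    show thesis by (rule that [OF abc(3,1,2) d(1) 3(2,1)])
  qed
qed

subsection \<open>The Ehrhart polynomial of a polygon\<close>

lemma dilate_mono: "P \<subseteq> Q \<Longrightarrow> dilate n P \<subseteq> dilate n Q"
  by (auto simp: dilate_def)

lemma dilate_Un: "dilate n (P \<union> Q) = dilate n P \<union> dilate n Q"
  by (auto simp: dilate_def)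

lemma dilate_Int: "n > 0 \<Longrightarrow> dilate n (P \<inter> Q) = dilate n P \<inter> dilate n Q"
  unfolding dilate_def by (rule image_Int) (simp add: inj_on_def)

lemma dilate_one [simp]: "dilate (Suc 0) P = P"
  by (simp add: dilate_def)

text \<open>Here \<open>A\<close> is the area and \<open>b\<close> is half the number of boundary points; by Pick's theorem
  \<open>A - b + 1\<close> is the number of interior points, but the inequality below suffices and is
  stable under gluing along a chord.\<close>

definition (in planar_lattice) pick_coefficients :: "(real \<times> real) set \<Rightarrow> real \<Rightarrow> real \<Rightarrow> bool" where
  "pick_coefficients P A b \<longleftrightarrow>
     (\<forall>n::nat. n > 0 \<longrightarrow> real (card (dilate n P \<inter> L)) = A * real n ^ 2 + b * real n + 1) \<and>
     0 \<le> A - b + 1 \<and> A - b + 1 \<le> real (card (interior P \<inter> L))"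

text \<open>\<open>A\<close> is half the parallelogram count and \<open>b\<close> half the sum of
  the edge lengths. Then \<open>A - b + 1\<close> is exactly the count of the open triangle, and the
  inclusion of the open triangle in the interior gives the bound.\<close>

lemma (in planar_lattice_frame) pick_coefficients_triangle:
  assumes a: "a \<in> L"
  shows "\<exists>A b. pick_coefficients (convex hull {a, a + u, a + v}) A b"
proof -
  let ?P = "convex hull {a, a + u, a + v}"
  let ?s = "lattice_length u + lattice_length v + lattice_length (u - v)"
  have P: "?P = {a + x *\<^sub>R u + y *\<^sub>R v | x y. 0 \<le> x \<and> 0 \<le> y \<and> x + y \<le> 1}"
    unfolding convex_hull_3_alt by simp
  have inj: "inj_on (\<lambda>(x, y). p + x *\<^sub>R u + y *\<^sub>R v) T" for p T
    by (auto simp: inj_on_def add.assoc cross2_combination_eq_iff [OF cross_uv])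
  have count: "card (dilate n ?P \<inter> L) = card (triangle_coords n)" if n: "n > 0" for n
  proof -
    let ?f = "\<lambda>(x, y). real n *\<^sub>R a + x *\<^sub>R u + y *\<^sub>R v"
    have L_iff: "real n *\<^sub>R a + x *\<^sub>R u + y *\<^sub>R v \<in> L \<longleftrightarrow> (x, y) \<in> coords" for x y
      unfolding in_coords add.assoc by (rule add_in_iff(2) [OF nat_scale_in [OF a]])
    have "dilate n ?P \<inter> L = ?f ` triangle_coords n"
    proof (intro equalityI subsetI)
      fix p assume p: "p \<in> dilate n ?P \<inter> L"
      then obtain x y where xy: "0 \<le> x" "0 \<le> y" "x + y \<le> 1" "p = real n *\<^sub>R (a + x *\<^sub>R u + y *\<^sub>R v)"
        unfolding dilate_def P by blast
      have eq: "p = real n *\<^sub>R a + (real n * x) *\<^sub>R u + (real n * y) *\<^sub>R v"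
        by (simp add: xy(4) scaleR_add_right)
      have "real n * x + real n * y \<le> real n"
        using mult_left_mono [OF xy(3), of "real n"] by (simp add: distrib_left)
      moreover have "(real n * x, real n * y) \<in> coords"
        using p L_iff eq by (metis IntD2)
      ultimately have "(real n * x, real n * y) \<in> triangle_coords n"
        using xy by (simp add: triangle_coords_def)
      then show "p \<in> ?f ` triangle_coords n"
        using eq by (intro image_eqI) auto
    next
      fix p assume "p \<in> ?f ` triangle_coords n"
      then obtain x y where xy: "(x, y) \<in> triangle_coords n" "p = real n *\<^sub>R a + x *\<^sub>R u + y *\<^sub>R v"
        by auto
      then have "p = real n *\<^sub>R (a + (x / real n) *\<^sub>R u + (y / real n) *\<^sub>R v)"
        using n by (simp add: scaleR_add_right)
      moreover have "0 \<le> x / real n" "0 \<le> y / real n" "x / real n + y / real n \<le> 1"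
        using xy n by (auto simp: triangle_coords_def simp flip: add_divide_distrib)
      ultimately have "p \<in> dilate n ?P"
        unfolding dilate_def P by blast
      then show "p \<in> dilate n ?P \<inter> L"
        using xy L_iff by (simp add: triangle_coords_def)
    qed
    then show ?thesis
      by (simp add: card_image [OF inj])
  qed
  have interior: "card open_triangle_coords \<le> card (interior ?P \<inter> L)"
  proof (rule card_inj_on_le [OF inj [of a]])
    show "(\<lambda>(x, y). a + x *\<^sub>R u + y *\<^sub>R v) ` open_triangle_coords \<subseteq> interior ?P \<inter> L"
    proof
      fix p assume "p \<in> (\<lambda>(x, y). a + x *\<^sub>R u + y *\<^sub>R v) ` open_triangle_coords"
      then obtain x y where p: "p = a + x *\<^sub>R u + y *\<^sub>R v"
        and xy: "0 < x" "0 < y" "x + y < 1" and "(x, y) \<in> coords"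
        by (auto simp: open_triangle_coords_def)
      then have "p \<in> L"
        unfolding in_coords p add.assoc by (intro add_in [OF a])
      then show "p \<in> interior ?P \<inter> L"
        using interior_triangle [OF cross_uv xy, of a] p by simp
    qed
    have "bounded (interior ?P)"
      by (rule bounded_subset [OF compact_imp_bounded [OF finite_imp_compact_convex_hull] interior_subset]) simp
    then show "finite (interior ?P \<inter> L)"
      by (rule finite_bounded)
  qed
  define A where "A = real parallelogram_count / 2"
  define b where "b = real ?s / 2"
  have "real (card (dilate n ?P \<inter> L)) = A * real n ^ 2 + b * real n + 1" if "n > 0" for n
  proof -
    have "2 * real (card (triangle_coords n)) = real (n * n * parallelogram_count + n * ?s + 2)"
      using card_triangle_coords [of n] by (metis of_nat_mult of_nat_numeral)
    then show ?thesis
      unfolding count [OF that] by (simp add: A_def b_def power2_eq_square field_simps)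
  qed
  moreover have "A - b + 1 = real (card open_triangle_coords)"
  proof -
    have "2 * real (card open_triangle_coords) + real ?s = real parallelogram_count + 2"
      using card_open_triangle_coords by linarith
    then show ?thesis
      by (simp add: A_def b_def field_simps)
  qed
  ultimately have "pick_coefficients ?P A b"
    using interior by (simp add: pick_coefficients_def)
  then show ?thesis by blast
qed

section \<open>Gluing along chords, and the boundary of a polygon\<close>

context planar_lattice
begin

text \<open>With \<open>l\<close> the lattice length of the chord, its \<open>n * l + 1\<close>
  points are counted twice, which subtracts \<open>l\<close> from the linear coefficient and leaves
  the constant 1. For the bound, \<open>A - b + 1\<close> is the sum of the two old values and
  \<open>l - 1\<close>; the latter counts the open chord, which lies in the interior of
  \<open>P\<close> and is disjoint from the interiors of the pieces.\<close>

lemma pick_coefficients_glue: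
  fixes P P1 P2 u w s t
  defines "P1 \<equiv> P \<inter> {p. 0 \<le> cross2 (w - u) (p - u)}" and "P2 \<equiv> P \<inter> {p. cross2 (w - u) (p - u) \<le> 0}"
  assumes P: "compact P" "convex P" and L: "u \<in> L" "w \<in> L"
    and chord: "P \<inter> {p. cross2 (w - u) (p - u) = 0} = closed_segment u w"
    and s: "s \<in> P" "0 < cross2 (w - u) (s - u)" and t: "t \<in> P" "cross2 (w - u) (t - u) < 0"
    and 1: "pick_coefficients P1 A1 b1" and 2: "pick_coefficients P2 A2 b2"
  shows "pick_coefficients P (A1 + A2) (b1 + b2 - real (lattice_length (w - u)))"
proof -
  have uw: "u \<noteq> w" using s by auto
  have fin: "finite (dilate n P \<inter> L)" for n
    by (rule finite_bounded) (use P in \<open>simp add: dilate_def compact_imp_bounded bounded_scaling\<close>)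
  have count: "real (card (dilate n P \<inter> L)) =
      (A1 + A2) * real n ^ 2 + (b1 + b2 - real (lattice_length (w - u))) * real n + 1" if n: "n > 0" for n
  proof -
    let ?B1 = "dilate n P1 \<inter> L" and ?B2 = "dilate n P2 \<inter> L"
    have "P1 \<union> P2 = P" by (auto simp: P1_def P2_def)
    then have "?B1 \<union> ?B2 = dilate n P \<inter> L"
      unfolding Int_Un_distrib2 [symmetric] dilate_Un [symmetric] by simp
    moreover have "P1 \<inter> P2 = closed_segment u w"
      unfolding chord [symmetric] by (auto simp only: P1_def P2_def)
    then have "?B1 \<inter> ?B2 = dilate n (closed_segment u w) \<inter> L"
      using dilate_Int [OF n, of P1 P2] by auto
    then have "card (?B1 \<inter> ?B2) = n * lattice_length (w - u) + 1"
      by (simp add: card_dilate_segment [OF L uw])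
    moreover have "card ?B1 + card ?B2 = card (?B1 \<union> ?B2) + card (?B1 \<inter> ?B2)"
      by (rule card_Un_Int) (rule finite_subset [OF _ fin [of n]];
        use dilate_mono [of _ P n] in \<open>auto simp: P1_def P2_def\<close>)+
    ultimately have "real (card (dilate n P \<inter> L)) + real (n * lattice_length (w - u) + 1)
        = real (card ?B1) + real (card ?B2)"
      by (metis of_nat_add)
    then show ?thesis
      using 1 2 n by (simp add: pick_coefficients_def algebra_simps)
  qed
  have seg: "real (card (open_segment u w \<inter> L)) + 1 = real (lattice_length (w - u))"
    using card_open_segment [OF L uw] by linarith
  let ?I = "interior P \<inter> L" and ?I1 = "interior P1 \<inter> L" and ?I2 = "interior P2 \<inter> L"
    and ?S = "open_segment u w \<inter> L"
  have d: "w - u \<noteq> 0" "u - w \<noteq> 0" using uw by auto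
  have int1: "interior P1 \<subseteq> {p. 0 < cross2 (w - u) (p - u)}"
    unfolding P1_def interior_Int interior_halfplane [OF d(1)] by blast
  have P2: "P2 = P \<inter> {p. 0 \<le> cross2 (u - w) (p - w)}"
    and flip: "{p. 0 < cross2 (u - w) (p - w)} = {p. cross2 (w - u) (p - u) < 0}"
  proof -
    have "cross2 (u - w) (p - w) = - cross2 (w - u) (p - u)" for p
      by (simp add: cross2_def algebra_simps)
    then show "P2 = P \<inter> {p. 0 \<le> cross2 (u - w) (p - w)}"
      and "{p. 0 < cross2 (u - w) (p - w)} = {p. cross2 (w - u) (p - u) < 0}"
      by (simp_all only: P2_def neg_0_le_iff_le neg_0_less_iff_less)
  qed
  have int2: "interior P2 \<subseteq> {p. cross2 (w - u) (p - u) < 0}"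
    unfolding P2 interior_Int interior_halfplane [OF d(2)] flip by blast
  have seg0: "open_segment u w \<subseteq> {p. cross2 (w - u) (p - u) = 0}"
    using chord segment_open_subset_closed [of u w] by blast
  have "?I1 \<union> ?I2 \<union> ?S \<subseteq> ?I"
  proof -
    have "u \<in> P" "w \<in> P"
      using chord by auto
    then have "open_segment u w \<subseteq> interior P"
      using open_segment_subset_interior [OF P(2)] s t by blast
    moreover have "interior P1 \<subseteq> interior P" "interior P2 \<subseteq> interior P"
      by (auto simp only: P1_def P2_def intro!: interior_mono)
    ultimately show ?thesis by blast
  qed
  moreover have fin_I: "finite ?I"
    by (rule finite_subset [OF _ fin [of 1]]) (use interior_subset in auto)
  ultimately have "card (?I1 \<union> ?I2 \<union> ?S) \<le> card ?I" and f: "finite (?I1 \<union> ?I2 \<union> ?S)"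
    by (metis card_mono, metis finite_subset)
  moreover have "card (?I1 \<union> ?I2 \<union> ?S) = card (?I1 \<union> ?I2) + card ?S"
    by (rule card_Un_disjoint) (use f int1 int2 seg0 in force)+
  moreover have "card (?I1 \<union> ?I2) = card ?I1 + card ?I2"
    by (rule card_Un_disjoint) (use f int1 int2 in force)+
  ultimately have "real (card ?I1) + real (card ?I2) + real (card ?S) \<le> real (card ?I)"
    by linarith
  then show ?thesis
    using 1 2 count seg unfolding pick_coefficients_def by auto
qed

text \<open>Induction on the number of points: redundant points are dropped, three points form a
  triangle, and four or more in convex position are cut by a chord. The witnesses \<open>s\<close>
  and \<open>t\<close> serve twice: each is missing from the opposite half, which is therefore
  smaller, and keeps its own half from being collinear.\<close>

theorem ex_pick_coefficients:
  assumes "finite S" "S \<subseteq> L" "\<not> collinear S"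
  shows "\<exists>A b. pick_coefficients (convex hull S) A b"
  using assms
proof (induction "card S" arbitrary: S rule: less_induct)
  case less
  show ?case
  proof (cases "convex_independent S")
    case False
    then obtain x where x: "x \<in> S" "x \<in> convex hull (S - {x})"
      by (auto simp: convex_independent_def)
    then have hull: "convex hull (S - {x}) = convex hull S"
      using hull_redundant [OF x(2)] by (simp add: insert_absorb)
    then have "\<not> collinear (S - {x})"
      using less.prems by (metis collinear_convex_hull_iff)
    moreover have "card (S - {x}) < card S"
      using less.prems x(1) by (meson card_Diff1_less)
    ultimately show ?thesis
      using less.hyps [of "S - {x}"] less.prems hull by auto
  next
    case indep: True
    have "\<not> card S \<le> 2"
      using less.prems collinear_small by blast
    then consider "card S = 3" | "card S \<ge> 4" by linarith
    then show ?thesis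
    proof cases
      case 1
      then obtain a b c where S: "S = {a, b, c}"
        by (auto simp: card_3_iff)
      have "cross2 (b - a) (c - a) \<noteq> 0"
      proof
        assume z: "cross2 (b - a) (c - a) = 0"
        have "b - a \<noteq> 0"
          using 1 S by (auto simp: card_insert_if split: if_splits)
        then obtain r where "c - a = r *\<^sub>R (b - a)"
          using z cross2_eq_0_iff by blast
        then have "collinear {b, a, c}"
          by (simp add: collinear_3 collinear_lemma)
        then have "collinear S"
          by (simp add: S insert_commute)
        then show False using less.prems by simp
      qed
      then interpret planar_lattice_frame L "b - a" "c - a"
        by unfold_locales (use less.prems S in \<open>auto intro: diff_in\<close>)
      have "a \<in> L" using less.prems S by simp
      from pick_coefficients_triangle [OF this] show ?thesis
        by (simp add: S)
    next
      case 2
      obtain u w s t where uw: "u \<in> S" "w \<in> S" and st: "s \<in> S" "t \<in> S"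
        "0 < cross2 (w - u) (s - u)" "cross2 (w - u) (t - u) < 0"
        by (rule ex_separating_chord [OF less.prems(1) indep less.prems(3) 2])
      note s = st(1,3) and t = st(2,4)
      let ?H1 = "{p. 0 \<le> cross2 (w - u) (p - u)}" and ?H2 = "{p. cross2 (w - u) (p - u) \<le> 0}"
      have flip: "?H2 = {p. 0 \<le> cross2 (u - w) (p - w)}"
      proof -
        have "cross2 (u - w) (p - w) = - cross2 (w - u) (p - u)" for p
          by (simp add: cross2_def algebra_simps)
        then show ?thesis by (simp only: neg_0_le_iff_le)
      qed
      have ne: "u \<noteq> w" using s by auto
      have zero: "cross2 (w - u) (u - u) = 0" "cross2 (w - u) (w - u) = 0"
        by (simp, rule cross2_simps(7))
      have "t \<notin> S \<inter> ?H1" "s \<notin> S \<inter> ?H2"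
        using s t by (simp_all only: Int_iff mem_Collect_eq not_le simp_thms)
      then have "S \<inter> ?H1 \<subset> S" "S \<inter> ?H2 \<subset> S"
        using s(1) t(1) by blast+
      then have smaller: "card (S \<inter> ?H1) < card S" "card (S \<inter> ?H2) < card S"
        using psubset_card_mono [OF less.prems(1)] by blast+
      have planar1: "\<not> collinear (S \<inter> ?H1)"
      proof -
        have "u \<in> S \<inter> ?H1" "w \<in> S \<inter> ?H1" "s \<in> S \<inter> ?H1"
          using uw s zero unfolding Int_iff mem_Collect_eq by (metis order_refl less_imp_le)+
        from not_collinearI [OF this] show ?thesis
          using s(2) by linarith
      qed
      have planar2: "\<not> collinear (S \<inter> ?H2)"
      proof -
        have "u \<in> S \<inter> ?H2" "w \<in> S \<inter> ?H2" "t \<in> S \<inter> ?H2"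
          using uw t zero unfolding Int_iff mem_Collect_eq by (metis order_refl less_imp_le)+
        from not_collinearI [OF this] show ?thesis
          using t(2) by linarith
      qed
      have "finite (S \<inter> H)" "S \<inter> H \<subseteq> L" for H
        using less.prems by auto
      then obtain A1 b1 A2 b2 where
        "pick_coefficients (convex hull (S \<inter> ?H1)) A1 b1" "pick_coefficients (convex hull (S \<inter> ?H2)) A2 b2"
        using less.hyps [OF smaller(1) _ _ planar1] less.hyps [OF smaller(2) _ _ planar2] by blast
      moreover have "convex hull (S \<inter> ?H1) = convex hull S \<inter> ?H1"
        using halfplane_cut_eq_hull [OF less.prems(1) indep uw ne] by simp
      moreover have "convex hull (S \<inter> ?H2) = convex hull S \<inter> ?H2"
        unfolding flip by (rule halfplane_cut_eq_hull [OF less.prems(1) indep uw(2,1) ne [symmetric], symmetric])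
      ultimately have "pick_coefficients (convex hull S \<inter> ?H1) A1 b1" "pick_coefficients (convex hull S \<inter> ?H2) A2 b2"
        by (simp_all only:)
      moreover have "compact (convex hull S)"
        by (rule finite_imp_compact_convex_hull [OF less.prems(1)])
      moreover have "u \<in> L" "w \<in> L"
        using uw less.prems by auto
      moreover note chord_eq_segment [OF less.prems(1) indep uw ne]
      moreover have "s \<in> convex hull S" "t \<in> convex hull S"
        using s t by (auto intro: hull_inc)
      ultimately show ?thesis
        using pick_coefficients_glue [OF _ convex_convex_hull] s(2) t(2) by blast
    qed
  qed
qed

lemma pick_coefficients_boundary:
  assumes S: "finite S" "S \<subseteq> L" "\<not> collinear S" and pick: "pick_coefficients (convex hull S) A b"
  shows "b \<ge> 3 / 2"
proof -
  let ?P = "convex hull S"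
  let ?E = "{x. x extreme_point_of ?P}"
  have E: "?E \<subseteq> S"
    using extreme_point_of_convex_hull by blast
  then have finE: "finite ?E"
    using S(1) by (rule finite_subset)
  \<comment> \<open>By Krein-Milman the extreme points span the hull, so two or fewer of them would
    make \<open>S\<close> collinear.\<close>
  have "?P = convex hull ?E"
    by (rule Krein_Milman_Minkowski) (simp_all add: S finite_imp_compact_convex_hull)
  then have "\<not> collinear ?E"
    using S(3) by (metis collinear_convex_hull_iff)
  then have card: "card ?E \<ge> 3"
    using collinear_small [OF finE] by linarith
  have fin: "finite (?P \<inter> L)"
    by (rule finite_bounded) (simp add: S compact_imp_bounded finite_imp_compact_convex_hull)
  have "(interior ?P \<inter> L) \<union> ?E \<subseteq> ?P \<inter> L"
    using E S(2) interior_subset hull_subset [of S convex] by blast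
  then have "card ((interior ?P \<inter> L) \<union> ?E) \<le> card (?P \<inter> L)"
    using fin by (rule card_mono [rotated])
  moreover have "card ((interior ?P \<inter> L) \<union> ?E) = card (interior ?P \<inter> L) + card ?E"
  proof (rule card_Un_disjoint)
    show "finite (interior ?P \<inter> L)"
      by (rule finite_subset [OF _ fin]) (use interior_subset in blast)
    show "(interior ?P \<inter> L) \<inter> ?E = {}"
      using extreme_point_not_in_interior by blast
  qed (rule finE)
  ultimately have "real (card (interior ?P \<inter> L)) + 3 \<le> real (card (?P \<inter> L))"
    using card by linarith
  moreover have "real (card (?P \<inter> L)) = A + b + 1"
    using pick unfolding pick_coefficients_def by (metis One_nat_def dilate_one mult.right_neutral of_nat_1 one_power2 zero_less_one)
  ultimately show ?thesis
    using pick unfolding pick_coefficients_def by linarith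
qed

end

subsection \<open>From planar polytopes to the plane\<close>

lemma finite_int_lattice_box: "finite {x \<in> int_lattice N. \<forall>i. \<bar>Poly_Mapping.lookup x i\<bar> \<le> c i}"
proof (rule finite_imageD)
  let ?X = "{x \<in> int_lattice N. \<forall>i. \<bar>Poly_Mapping.lookup x i\<bar> \<le> c i}"
  let ?f = "\<lambda>x. restrict (Poly_Mapping.lookup x) {..<N}"
  have "?f ` ?X \<subseteq> (\<Pi>\<^sub>E i\<in>{..<N}. {t \<in> \<int>. \<bar>t\<bar> \<le> c i})"
    by (auto simp: int_lattice_def image_subset_iff restrict_PiE_iff)
  moreover have "finite (\<Pi>\<^sub>E i\<in>{..<N}. {t \<in> \<int>. \<bar>t\<bar> \<le> c i})"
    by (intro finite_PiE) (auto intro: finite_abs_int_segment)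
  ultimately show "finite (?f ` ?X)"
    by (rule finite_subset)
  show "inj_on ?f ?X"
  proof (rule inj_onI)
    fix x y assume xy: "x \<in> ?X" "y \<in> ?X" "?f x = ?f y"
    show "x = y"
    proof (rule poly_mapping_eqI)
      fix i
      show "Poly_Mapping.lookup x i = Poly_Mapping.lookup y i"
      proof (cases "i < N")
        case True
        then show ?thesis
          using fun_cong [OF xy(3), of i] by simp
      next
        case False
        then show ?thesis
          using xy by (auto simp: int_lattice_def keys_subset_iff)
      qed
    qed
  qed
qed

lemma int_lattice_add: "x \<in> int_lattice N \<Longrightarrow> y \<in> int_lattice N \<Longrightarrow> x + y \<in> int_lattice N"
  by (auto simp: int_lattice_def keys_subset_iff lookup_add)

lemma int_lattice_uminus: "x \<in> int_lattice N \<Longrightarrow> - x \<in> int_lattice N"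
  by (auto simp: int_lattice_def keys_subset_iff)

lemma int_lattice_diff: "x \<in> int_lattice N \<Longrightarrow> y \<in> int_lattice N \<Longrightarrow> x - y \<in> int_lattice N"
  using int_lattice_add [of x N "- y"] int_lattice_uminus by simp

lemma int_lattice_nat_scale: "x \<in> int_lattice N \<Longrightarrow> real n *\<^sub>R x \<in> int_lattice N"
  by (auto simp: int_lattice_def keys_subset_iff)

text \<open>Discreteness is the only real condition: \<open>f\<close> maps a bounded set into a
  coordinate box, which holds finitely many integer points, and injectivity pulls finiteness
  back.\<close>

lemma planar_lattice_chart:
  fixes f :: "real \<times> real \<Rightarrow> nat \<Rightarrow>\<^sub>0 real"
  assumes f: "linear f" "inj f"
  shows "planar_lattice {p. f p \<in> int_lattice N}"
proof
  show "0 \<in> {p. f p \<in> int_lattice N}"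
    by (simp add: linear_0 [OF f(1)] int_lattice_def)
  show "a + b \<in> {p. f p \<in> int_lattice N}"
    if "a \<in> {p. f p \<in> int_lattice N}" "b \<in> {p. f p \<in> int_lattice N}" for a b
    using that by (simp add: linear_add [OF f(1)] int_lattice_add)
  show "- a \<in> {p. f p \<in> int_lattice N}" if "a \<in> {p. f p \<in> int_lattice N}" for a
    using that by (simp add: linear_neg [OF f(1)] int_lattice_uminus)
  fix B :: "(real \<times> real) set" assume "bounded B"
  then obtain r where r: "\<And>p. p \<in> B \<Longrightarrow> norm p \<le> r"
    by (auto simp: bounded_iff)
  define c where "c i = r * \<bar>Poly_Mapping.lookup (f (1, 0)) i\<bar> + r * \<bar>Poly_Mapping.lookup (f (0, 1)) i\<bar>" for i
  have "f ` (B \<inter> {p. f p \<in> int_lattice N}) \<subseteq> {x \<in> int_lattice N. \<forall>i. \<bar>Poly_Mapping.lookup x i\<bar> \<le> c i}"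
  proof
    fix q assume "q \<in> f ` (B \<inter> {p. f p \<in> int_lattice N})"
    then obtain p where q: "q = f p" "p \<in> B" "f p \<in> int_lattice N" by blast
    have "\<bar>Poly_Mapping.lookup q i\<bar> \<le> c i" for i
    proof -
      have "p = fst p *\<^sub>R (1, 0) + snd p *\<^sub>R (0, 1)"
        by (simp add: prod_eq_iff)
      then have "f p = fst p *\<^sub>R f (1, 0) + snd p *\<^sub>R f (0, 1)"
        by (metis linear_add [OF f(1)] linear_scale [OF f(1)])
      then have "\<bar>Poly_Mapping.lookup q i\<bar>
          \<le> \<bar>fst p\<bar> * \<bar>Poly_Mapping.lookup (f (1, 0)) i\<bar> + \<bar>snd p\<bar> * \<bar>Poly_Mapping.lookup (f (0, 1)) i\<bar>"
        unfolding q(1) by (simp add: lookup_add flip: abs_mult)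
      also have "\<dots> \<le> c i"
        unfolding c_def using norm_fst_le [of "fst p" "snd p"] norm_snd_le [of "snd p" "fst p"] r [OF q(2)]
        by (intro add_mono mult_right_mono) auto
      finally show ?thesis .
    qed
    then show "q \<in> {x \<in> int_lattice N. \<forall>i. \<bar>Poly_Mapping.lookup x i\<bar> \<le> c i}"
      using q by simp
  qed
  then have "finite (f ` (B \<inter> {p. f p \<in> int_lattice N}))"
    by (rule finite_subset [OF _ finite_int_lattice_box])
  then show "finite (B \<inter> {p. f p \<in> int_lattice N})"
    by (rule finite_imageD) (rule inj_on_subset [OF f(2)], simp)
qed

text \<open>Moving a vertex \<open>a\<close> to the origin is harmless because
  \<open>real n *\<^sub>R a\<close> is an integer point for every \<open>n\<close>, so the counts of
  all dilates can be read off in the plane.\<close>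

lemma ehrhart_poly_polygon:
  assumes P: "lattice_polytope N P" "affine_dimension P = 2"
  obtains A b :: real where
    "\<And>n::nat. n > 0 \<Longrightarrow> poly [:1, b, A:] (real n) = real (card (dilate n P \<inter> int_lattice N))"
    "b \<ge> 3 / 2" "0 \<le> A - b + 1"
proof -
  obtain S where S: "finite S" "S \<subseteq> int_lattice N" "P = convex hull S"
    using P(1) by (auto simp: lattice_polytope_def)
  have "S \<noteq> {}"
    using P(2) S(3) by (auto simp: affine_dimension_def dim_eq_card_independent [OF independent_empty])
  then obtain a where a: "a \<in> S" by blast
  let ?T = "(\<lambda>x. x - a) ` S"
  have dimT: "dim ?T = 2"
    using affine_dimension_eq_dim [OF a] P(2) S(3) by (simp add: affine_hull_convex_hull)
  \<comment> \<open>The basis is chosen among the differences of vertices, so that 0,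
    \<open>(1, 0)\<close> and \<open>(0, 1)\<close> are points of \<open>S0\<close>; they witness
    that \<open>S0\<close> is not collinear.\<close>
  obtain B where B: "B \<subseteq> ?T" "independent B" "?T \<subseteq> span B" "card B = 2"
    using basis_exists [of ?T] dimT by metis
  then obtain u v where uv: "B = {u, v}" "u \<noteq> v"
    by (auto simp: card_2_iff)
  define f where "f p = fst p *\<^sub>R u + snd p *\<^sub>R v" for p :: "real \<times> real"
  have lin: "linear f"
    by (rule linearI) (simp_all add: f_def algebra_simps)
  have "p = 0" if "f p = 0" for p
  proof -
    let ?c = "\<lambda>x. if x = u then fst p else snd p"
    have "finite B" "(\<Sum>x\<in>B. ?c x *\<^sub>R x) = 0"
      using that uv by (simp_all add: f_def)
    then have "?c x = 0" if "x \<in> B" for x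
      using independentD [OF B(2), of B ?c] that by simp
    from this [of u] this [of v] show ?thesis
      using uv by (simp add: prod_eq_iff)
  qed
  then have inj: "inj f"
    using linear_injective_0 [OF lin] by blast
  have range: "?T \<subseteq> range f"
  proof
    fix x assume "x \<in> ?T"
    then have "x \<in> span {u, v}" using B uv by blast
    then obtain r where "x - r *\<^sub>R u \<in> span {v}"
      by (auto simp: span_insert)
    then obtain s where "x - r *\<^sub>R u = s *\<^sub>R v"
      by (auto simp: span_singleton)
    then have "x = f (r, s)"
      by (simp add: f_def algebra_simps)
    then show "x \<in> range f" by blast
  qed
  define L where "L = {p. f p \<in> int_lattice N}"
  interpret planar_lattice L
    unfolding L_def by (rule planar_lattice_chart [OF lin inj])
  define S0 where "S0 = f -` ?T"
  have image_S0: "f ` S0 = ?T"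
    using range by (auto simp: S0_def)
  have fin: "finite S0"
    unfolding S0_def using S(1) inj by (intro finite_vimageI) auto
  have "S0 \<subseteq> L"
    using S(2) a by (auto simp: S0_def L_def intro!: int_lattice_diff)
  moreover have "\<not> collinear S0"
  proof -
    have "f (1, 0) = u" "f (0, 1) = v" "f 0 = 0"
      by (simp_all add: f_def)
    moreover have "u \<in> ?T" "v \<in> ?T" "0 \<in> ?T"
      using B uv a by auto
    ultimately have "0 \<in> S0" "(1, 0) \<in> S0" "(0, 1) \<in> S0"
      by (simp_all only: S0_def vimage_eq)
    moreover have "cross2 ((1, 0) - 0) ((0, 1) - 0) \<noteq> 0"
      by (simp add: cross2_def)
    ultimately show ?thesis
      by (rule not_collinearI)
  qed
  ultimately obtain A b where pick: "pick_coefficients (convex hull S0) A b"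
    using ex_pick_coefficients [OF fin] by blast
  have "b \<ge> 3 / 2"
    by (rule pick_coefficients_boundary) fact+
  have "S = (\<lambda>x. a + x) ` ?T"
    by (simp add: image_image)
  then have P_eq: "P = (\<lambda>p. a + f p) ` (convex hull S0)"
    unfolding S(3) by (metis convex_hull_translation convex_hull_linear_image [OF lin] image_S0 image_image)
  have count: "card (dilate n P \<inter> int_lattice N) = card (dilate n (convex hull S0) \<inter> L)" for n
  proof -
    let ?g = "\<lambda>p. real n *\<^sub>R a + f p"
    have "real n *\<^sub>R (a + f p) = ?g (real n *\<^sub>R p)" for p
      by (simp add: scaleR_add_right linear_scale [OF lin])
    then have image: "dilate n P = ?g ` dilate n (convex hull S0)"
      unfolding dilate_def P_eq image_image by simp
    have iff: "?g p \<in> int_lattice N \<longleftrightarrow> p \<in> L" for p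
    proof -
      have "real n *\<^sub>R a \<in> int_lattice N"
        using a S(2) by (auto intro: int_lattice_nat_scale)
      then show ?thesis
        unfolding L_def mem_Collect_eq by (metis add_diff_cancel_left' int_lattice_add int_lattice_diff)
    qed
    have "dilate n P \<inter> int_lattice N = ?g ` (dilate n (convex hull S0) \<inter> L)"
      unfolding image using iff by (auto simp only: image_iff Int_iff)
    moreover have "inj_on ?g X" for X
      by (rule inj_onI) (simp add: inj_eq [OF inj])
    ultimately show ?thesis
      by (simp add: card_image)
  qed
  show thesis
  proof (rule that [of b A])
    fix n :: nat assume "n > 0"
    then show "poly [:1, b, A:] (real n) = real (card (dilate n P \<inter> int_lattice N))"
      using pick by (simp add: count pick_coefficients_def power2_eq_square algebra_simps)
  qed (use pick \<open>b \<ge> 3 / 2\<close> in \<open>simp_all add: pick_coefficients_def\<close>)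
qed

theorem magic_positive_ehrhart_poly_double_polygon:
  assumes P: "lattice_polytope N P" "affine_dimension P = 2"
  shows "magic_positive (ehrhart_poly N (dilate 2 P))"
proof -
  obtain A b :: real where count:
    "\<And>n::nat. n > 0 \<Longrightarrow> poly [:1, b, A:] (real n) = real (card (dilate n P \<inter> int_lattice N))"
    and b: "b \<ge> 3 / 2" and I: "0 \<le> A - b + 1"
    using ehrhart_poly_polygon [OF P] by blast
  \<comment> \<open>The two bounds give \<open>A \<ge> 1/2\<close>, so the polynomial really has
    degree 2, the dimension.\<close>
  have A: "A > 0" using b I by linarith
  have "degree [:1, b, A:] = affine_dimension P"
    using A P(2) by simp
  from ehrhart_poly_dilate [OF this _ count, of 2]
  have E: "ehrhart_poly N (dilate 2 P) = [:1, 2 * b, 4 * A:]"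
    by (simp add: pcompose_pCons)
  \<comment> \<open>Comparing coefficients forces \<open>c 0 = 1\<close>,
    \<open>2 * c 0 + c 1 = 2 * b\<close> and \<open>c 0 + c 1 + c 2 = 4 * A\<close>.\<close>
  define c :: "nat \<Rightarrow> real" where
    "c i = (if i = 0 then 1 else if i = 1 then 2 * b - 2 else 4 * A - 2 * b + 1)" for i
  have deg: "degree [:1, 2 * b, 4 * A:] = 2"
    using A by simp
  have "\<forall>i \<le> 2. c i \<ge> 0"
    using b I by (auto simp: c_def)
  moreover have "[:1, 2 * b, 4 * A:] = (\<Sum>i \<le> 2. smult (c i) ([:0, 1:] ^ i * [:1, 1:] ^ (2 - i)))"
    by (simp add: c_def numeral_2_eq_2)
  ultimately show ?thesis
    unfolding magic_positive_def E deg by blast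
qed

theorem theorem1p5:
  shows "(\<forall>N P. lattice_polytope N P \<and> affine_dimension P = 2 \<and> ehrhart_positive N P \<longrightarrow>
            magic_positive (ehrhart_poly N (dilate 2 P)))
       \<and> (\<forall>(d::nat) (k::nat). d \<ge> 3 \<and> k \<ge> 1 \<longrightarrow>
            (\<exists>N P. lattice_polytope N P \<and> affine_dimension P = d \<and> ehrhart_positive N P \<and>
               \<not> magic_positive (ehrhart_poly N (dilate k P))))"
proof (intro conjI allI impI; elim conjE)
  fix N P assume "lattice_polytope N P" "affine_dimension P = 2"
  then show "magic_positive (ehrhart_poly N (dilate 2 P))"
    by (rule magic_positive_ehrhart_poly_double_polygon)
next
  fix d k :: nat assume "d \<ge> 3" "k \<ge> 1"
  then show "\<exists>N P. lattice_polytope N P \<and> affine_dimension P = d \<and> ehrhart_positive N P \<and>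
      \<not> magic_positive (ehrhart_poly N (dilate k P))"
    by (rule ex_ehrhart_positive_not_magic_positive_dilate)
qed

end
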